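(* Let $\hat\Sigma$ and $\Sigma^+$ be the matrices produced in steps (2) and (3) of DP-Thresholding. Then $$\mathbb{E}\|\hat\Sigma-\Sigma\|_2^2=O\Big(\frac{s^2\log p\,\log(1/\delta)}{n\epsilon^2}\Big)\quad\text{and}\quad \mathbb{E}\|\Sigma^+-\Sigma\|_2^2=O\Big(\frac{s^2\log p\,\log(1/\delta)}{n\epsilon^2}\Big),$$ where $\|\cdot\|_2$ is the spectral norm, the expectation is over both the samples and the algorithm's noise, and the implied constants depend only on $\sigma^2$.
   Context: Setting: $x_1,\dots,x_n$ are i.i.d. random vectors in $\mathbb{R}^p$ (high-dimensional regime $p\gg n\ge \mathrm{poly}(\log p)$) with $\mathbb{E}x_i=0$, $\|x_i\|_2\le 1$ almost surely, sub-Gaussian with parameter $\sigma^2$: $\mathbb{P}\{|v^Tx_i|>t\}\le e^{-t^2/(2\sigma^2)}$ for all $t>0$ and all unit vectors $v$. The covariance $\Sigma=(\sigma_{ij})$ lies in $\mathcal{G}_0(s)$: for each column $j$, the vector of off-diagonal entries $(\sigma_{ij})_{i\neq j}$ has at most $s$ nonzeros. $\Sigma^*=(\sigma^*_{ij})=\frac1n\sum_i x_ix_i^T$. The constant $\gamma>0$ (depending only on $\sigma^2$) is one for which there is a constant $C_1$ with $\mathbb{P}(|\sigma^*_{ij}-\sigma_{ij}|>t)\le C_1e^{-8nt^2/\gamma^2}$ for all $i,j$ and all sufficiently small $|t|$, in particular $\mathbb{P}(|\sigma^*_{ij}-\sigma_{ij}|>\gamma\sqrt{\log p/n})\le C_1p^{-8}$.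 DP-Thresholding algorithm with input $0<\epsilon,\delta\le1$: (1) $\tilde\Sigma=(\tilde\sigma_{ij})=\Sigma^*+N$, where $N$ is a symmetric $p\times p$ matrix whose upper-triangular entries (including the diagonal) are i.i.d. $\mathcal{N}(0,\sigma_1^2)$, independent of the data, with $\sigma_1^2=\frac{2\ln(1.25/\delta)}{n^2\epsilon^2}$, lower triangle copied from upper; (2) $\hat\sigma_{ij}=\tilde\sigma_{ij}\cdot\mathbb{I}[|\tilde\sigma_{ij}|>\tau]$ with $\tau=\gamma\sqrt{\frac{\log p}{n}}+\frac{4\sqrt{2\ln(1.25/\delta)}\sqrt{\log p}}{n\epsilon}$; (3) with eigendecomposition $\hat\Sigma=\sum_i\lambda_iv_iv_i^T$, output $\Sigma^+=\sum_i\max\{\lambda_i,0\}v_iv_i^T$.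
   Formalization: The bound uses log(1.25/δ) in place of log(1/δ), and s ≥ 1 is assumed: at δ = 1 or s = 0 the stated bound is zero while the expected error is positive; for δ bounded away from 1 the two logarithms agree up to a constant. *)

theory Defs
  imports "HOL-Probability.Probability"
begin

(* Vectors in R^p are functions nat => real, only indices < p matter;
   p x p matrices are functions nat => nat => real, only indices < p matter. *)

definition spec_norm :: "nat \<Rightarrow> (nat \<Rightarrow> nat \<Rightarrow> real) \<Rightarrow> real" where
  "spec_norm p A = (SUP x\<in>{x :: nat \<Rightarrow> real. (\<Sum>i<p. (x i)\<^sup>2) = 1}.
        sqrt (\<Sum>a<p. (\<Sum>b<p. A a b * x b)\<^sup>2))"

definition cov_mat :: "(nat \<Rightarrow> real) measure \<Rightarrow> nat \<Rightarrow> nat \<Rightarrow> real" where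
  "cov_mat D a b = (\<integral>x. x a * x b \<partial>D)"

definition sample_cov :: "nat \<Rightarrow> (nat \<Rightarrow> nat \<Rightarrow> real) \<Rightarrow> nat \<Rightarrow> nat \<Rightarrow> real" where
  "sample_cov n X a b = (\<Sum>k<n. X k a * X k b) / real n"

definition in_G0 :: "nat \<Rightarrow> nat \<Rightarrow> (nat \<Rightarrow> nat \<Rightarrow> real) \<Rightarrow> bool" where
  "in_G0 p s A = (\<forall>j<p. card {i. i < p \<and> i \<noteq> j \<and> A i j \<noteq> 0} \<le> s)"

definition upper_idx :: "nat \<Rightarrow> (nat \<times> nat) set" where
  "upper_idx p = {(i, j). i \<le> j \<and> j < p}"

definition sym_noise :: "(nat \<times> nat \<Rightarrow> real) \<Rightarrow> nat \<Rightarrow> nat \<Rightarrow> real" where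
  "sym_noise z a b = (if a \<le> b then z (a, b) else z (b, a))"

definition dp_sigma1 :: "nat \<Rightarrow> real \<Rightarrow> real \<Rightarrow> real" where
  "dp_sigma1 n \<epsilon> \<delta> = sqrt (2 * ln (1.25 / \<delta>)) / (real n * \<epsilon>)"

definition dp_tau :: "real \<Rightarrow> nat \<Rightarrow> nat \<Rightarrow> real \<Rightarrow> real \<Rightarrow> real" where
  "dp_tau \<gamma> n p \<epsilon> \<delta> = \<gamma> * sqrt (ln (real p) / real n)
      + 4 * sqrt (2 * ln (1.25 / \<delta>)) * sqrt (ln (real p)) / (real n * \<epsilon>)"

definition sample_space :: "(nat \<Rightarrow> real) measure \<Rightarrow> nat \<Rightarrow> (nat \<Rightarrow> nat \<Rightarrow> real) measure" where
  "sample_space D n = PiM {..<n} (\<lambda>_. D)"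

definition noise_space :: "nat \<Rightarrow> real \<Rightarrow> (nat \<times> nat \<Rightarrow> real) measure" where
  "noise_space p \<sigma>1 = PiM (upper_idx p) (\<lambda>_. density lborel (normal_density 0 \<sigma>1))"

definition dp_tilde :: "nat \<Rightarrow> (nat \<Rightarrow> nat \<Rightarrow> real) \<Rightarrow> (nat \<times> nat \<Rightarrow> real) \<Rightarrow> nat \<Rightarrow> nat \<Rightarrow> real" where
  "dp_tilde n X z a b = sample_cov n X a b + sym_noise z a b"

definition threshold :: "real \<Rightarrow> (nat \<Rightarrow> nat \<Rightarrow> real) \<Rightarrow> nat \<Rightarrow> nat \<Rightarrow> real" where
  "threshold \<tau> A a b = (if \<bar>A a b\<bar> > \<tau> then A a b else 0)"

definition dp_hat :: "real \<Rightarrow> nat \<Rightarrow> nat \<Rightarrow> real \<Rightarrow> real \<Rightarrow> (nat \<Rightarrow> nat \<Rightarrow> real) \<Rightarrow> (nat \<times> nat \<Rightarrow> real) \<Rightarrow> nat \<Rightarrow> nat \<Rightarrow> real" where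
  "dp_hat \<gamma> n p \<epsilon> \<delta> X z = threshold (dp_tau \<gamma> n p \<epsilon> \<delta>) (dp_tilde n X z)"

definition psd_part :: "nat \<Rightarrow> (nat \<Rightarrow> nat \<Rightarrow> real) \<Rightarrow> nat \<Rightarrow> nat \<Rightarrow> real" where
  "psd_part p A = (SOME M. \<exists>(v :: nat \<Rightarrow> nat \<Rightarrow> real) (lam :: nat \<Rightarrow> real).
      (\<forall>i<p. \<forall>j<p. (\<Sum>k<p. v i k * v j k) = (if i = j then 1 else 0)) \<and>
      (\<forall>a<p. \<forall>b<p. A a b = (\<Sum>i<p. lam i * v i a * v i b)) \<and>
      M = (\<lambda>a b. if a < p \<and> b < p then (\<Sum>i<p. max (lam i) 0 * v i a * v i b) else 0))"

definition dp_plus :: "real \<Rightarrow> nat \<Rightarrow> nat \<Rightarrow> real \<Rightarrow> real \<Rightarrow> (nat \<Rightarrow> nat \<Rightarrow> real) \<Rightarrow> (nat \<times> nat \<Rightarrow> real) \<Rightarrow> nat \<Rightarrow> nat \<Rightarrow> real" where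
  "dp_plus \<gamma> n p \<epsilon> \<delta> X z = psd_part p (dp_hat \<gamma> n p \<epsilon> \<delta> X z)"

end

theory Submission
  imports Defs
begin

text \<open>
  Let \<open>G\<close> be the event that every entry of \<open>\<Sigma>\<^sup>*\<close> is within the first summand of \<open>\<tau>\<close> of the entry of
  \<open>\<Sigma>\<close>, and every noise entry is within the second. On \<open>G\<close> thresholding kills all entries outside
  the support of \<open>\<Sigma>\<close> and changes the others by at most \<open>2\<tau>\<close>, so every column of the symmetric
  difference \<open>H - \<Sigma>\<close>, with \<open>H\<close> the thresholded matrix, has absolute sum at most \<open>2(s + 1)\<tau>\<close>,
  which bounds its spectral norm. The complement of \<open>G\<close> has probability \<open>O(p\<^sup>-\<^sup>4)\<close>, and there the
  squared Frobenius norm is a sum of \<open>p\<^sup>2\<close> terms with bounded moments, which is negligible since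
  \<open>n \<le> p\<close>. Finally \<open>\<Sigma>\<close> is positive semidefinite, so the negative eigenvalues of \<open>H\<close> are bounded in
  absolute value by the spectral norm of \<open>H - \<Sigma>\<close>, and removing them at most doubles the error.
\<close>

section \<open>Spectral theorem\<close>

text \<open>The dimension \<open>p\<close> is a variable, so Euclidean space is modelled by
  functions on all naturals, and the inner product only looks at coordinates below \<open>p\<close>.
  Consequently \<open>dot p x x = 0\<close> forces \<open>x\<close> to vanish below \<open>p\<close>
  and says nothing beyond.\<close>

definition dot :: "nat \<Rightarrow> (nat \<Rightarrow> real) \<Rightarrow> (nat \<Rightarrow> real) \<Rightarrow> real" where
  "dot p x y = (\<Sum>i<p. x i * y i)"

definition mulv :: "nat \<Rightarrow> (nat \<Rightarrow> nat \<Rightarrow> real) \<Rightarrow> (nat \<Rightarrow> real) \<Rightarrow> nat \<Rightarrow> real" where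
  "mulv p A x a = (\<Sum>b<p. A a b * x b)"

lemma dot_commute: "dot p x y = dot p y x"
  by (simp add: dot_def mult.commute)

lemma dot_add_left: "dot p (\<lambda>a. x a + y a) z = dot p x z + dot p y z"
  by (simp add: dot_def sum.distrib algebra_simps)

lemma dot_diff_left: "dot p (\<lambda>a. x a - y a) z = dot p x z - dot p y z"
  by (simp add: dot_def sum_subtractf algebra_simps)

lemma dot_scale_left: "dot p (\<lambda>a. c * x a) z = c * dot p x z"
  by (simp add: dot_def sum_distrib_left algebra_simps)

lemma dot_sum_left: "dot p (\<lambda>a. \<Sum>i\<in>I. f i a) z = (\<Sum>i\<in>I. dot p (f i) z)"
  unfolding dot_def by (simp add: sum_distrib_right) (rule sum.swap)

lemma dot_self: "dot p x x = (\<Sum>i<p. (x i)\<^sup>2)"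
  by (simp add: dot_def power2_eq_square)

lemma dot_self_nonneg: "0 \<le> dot p x x"
  by (simp add: dot_self sum_nonneg)

lemma dot_self_eq_0: "dot p x x = 0 \<longleftrightarrow> (\<forall>i<p. x i = 0)"
  by (auto simp: dot_self sum_nonneg_eq_0_iff)

lemma dot_Cauchy_Schwarz: "(dot p x y)\<^sup>2 \<le> dot p x x * dot p y y"
  using Cauchy_Schwarz_ineq_sum[of x y "{..<p}"] by (simp add: dot_def power2_eq_square)

lemma dot_unit_right: "j < p \<Longrightarrow> dot p x (\<lambda>a. if a = j then 1 else 0) = x j"
  by (simp add: dot_def if_distrib cong: if_cong)

lemma dot_mulv_commute:
  assumes "\<And>a b. a < p \<Longrightarrow> b < p \<Longrightarrow> A a b = A b a"
  shows "dot p x (mulv p A y) = dot p (mulv p A x) y"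
proof -
  have "dot p x (mulv p A y) = (\<Sum>a<p. \<Sum>b<p. x a * A a b * y b)"
    by (simp add: dot_def mulv_def sum_distrib_left mult.assoc)
  also have "\<dots> = (\<Sum>b<p. \<Sum>a<p. x a * A a b * y b)"
    by (rule sum.swap)
  also have "\<dots> = (\<Sum>b<p. \<Sum>a<p. A b a * x a * y b)"
    using assms by (intro sum.cong refl) (simp add: mult_ac)
  also have "\<dots> = dot p (mulv p A x) y"
    by (simp add: dot_def mulv_def sum_distrib_right)
  finally show ?thesis .
qed

section \<open>Orthonormal systems and orthogonal residuals\<close>

definition orthonormal :: "nat \<Rightarrow> nat \<Rightarrow> (nat \<Rightarrow> nat \<Rightarrow> real) \<Rightarrow> bool" where
  "orthonormal p k v \<longleftrightarrow> (\<forall>i<k. \<forall>j<k. dot p (v i) (v j) = (if i = j then 1 else 0))"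

text \<open>The Gram-Schmidt residual: for orthonormal \<open>v\<close> it is the projection of
  \<open>x\<close> to the orthogonal complement of the first \<open>k\<close> vectors.\<close>

definition resid :: "nat \<Rightarrow> nat \<Rightarrow> (nat \<Rightarrow> nat \<Rightarrow> real) \<Rightarrow> (nat \<Rightarrow> real) \<Rightarrow> nat \<Rightarrow> real" where
  "resid p k v x = (\<lambda>a. x a - (\<Sum>i<k. dot p x (v i) * v i a))"

lemma dot_resid_left:
  "dot p (resid p k v x) y = dot p x y - (\<Sum>i<k. dot p x (v i) * dot p (v i) y)"
  by (simp add: resid_def dot_diff_left dot_sum_left dot_scale_left)

lemma dot_resid_orthonormal:
  assumes "orthonormal p k v" "j < k"
  shows "dot p (resid p k v x) (v j) = 0"
proof -
  have "(\<Sum>i<k. dot p x (v i) * dot p (v i) (v j)) = (\<Sum>i<k. if i = j then dot p x (v i) else 0)"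
    using assms by (intro sum.cong) (auto simp: orthonormal_def)
  also have "\<dots> = dot p x (v j)" using assms by simp
  finally show ?thesis by (simp add: dot_resid_left)
qed

text \<open>Pythagoras: the residual is orthogonal to every \<open>v i\<close>, so pairing it with
  itself is the same as pairing it with \<open>x\<close>.\<close>

lemma dot_resid_self:
  assumes "orthonormal p k v"
  shows "dot p (resid p k v x) (resid p k v x) = dot p x x - (\<Sum>i<k. (dot p x (v i))\<^sup>2)"
proof -
  have "dot p (resid p k v x) (resid p k v x)
      = dot p x (resid p k v x) - (\<Sum>i<k. dot p x (v i) * dot p (v i) (resid p k v x))"
    by (rule dot_resid_left)
  also have "(\<Sum>i<k. dot p x (v i) * dot p (v i) (resid p k v x)) = 0"
    using dot_resid_orthonormal[OF assms] by (intro sum.neutral) (auto simp: dot_commute[of p "v _"])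
  also have "dot p x (resid p k v x) = dot p x x - (\<Sum>i<k. (dot p x (v i))\<^sup>2)"
  proof -
    have "dot p (v i) x = dot p x (v i)" for i by (rule dot_commute)
    then show ?thesis
      by (subst dot_commute) (simp add: dot_resid_left power2_eq_square)
  qed
  finally show ?thesis by simp
qed

lemma Bessel_inequality:
  "orthonormal p k v \<Longrightarrow> (\<Sum>i<k. (dot p x (v i))\<^sup>2) \<le> dot p x x"
  using dot_resid_self[of p k v x] dot_self_nonneg[of p "resid p k v x"] by simp

text \<open>The left side is the trace of the projection to the orthogonal complement, hence its
  dimension. This count stands in for dimension theory: for \<open>k < p\<close> it is positive and
  yields a further orthogonal vector, for \<open>k = p\<close> it is zero and yields
  completeness.\<close>

lemma sum_resid_unit_vectors:
  assumes "orthonormal p k v"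
  shows "(\<Sum>j<p. dot p (resid p k v (\<lambda>a. if a = j then 1 else 0))
                       (resid p k v (\<lambda>a. if a = j then 1 else 0))) = real p - real k"
proof -
  let ?e = "\<lambda>j a. if a = j then 1 else (0::real)"
  have "dot p (resid p k v (?e j)) (resid p k v (?e j)) = 1 - (\<Sum>i<k. (v i j)\<^sup>2)" if "j < p" for j
    using that by (simp add: dot_resid_self[OF assms] dot_unit_right dot_commute[of p "?e j" "v _"])
  then have "(\<Sum>j<p. dot p (resid p k v (?e j)) (resid p k v (?e j)))
      = (\<Sum>j<p. 1 - (\<Sum>i<k. (v i j)\<^sup>2))"
    by (intro sum.cong) auto
  also have "\<dots> = real p - (\<Sum>j<p. \<Sum>i<k. (v i j)\<^sup>2)"
    by (simp add: sum_subtractf)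
  also have "(\<Sum>j<p. \<Sum>i<k. (v i j)\<^sup>2) = (\<Sum>i<k. dot p (v i) (v i))"
    unfolding dot_self by (rule sum.swap)
  also have "\<dots> = real k"
    using assms by (simp add: orthonormal_def)
  finally show ?thesis .
qed

lemma ex_orthogonal_vector:
  assumes "orthonormal p k v" "k < p"
  shows "\<exists>x. dot p x x > 0 \<and> (\<forall>i<k. dot p x (v i) = 0)"
proof -
  let ?r = "\<lambda>j. resid p k v (\<lambda>a. if a = j then 1 else 0)"
  have "\<exists>j<p. dot p (?r j) (?r j) \<noteq> 0"
  proof (rule ccontr)
    assume "\<not> ?thesis"
    then have "(\<Sum>j<p. dot p (?r j) (?r j)) = 0" by simp
    with sum_resid_unit_vectors[OF assms(1)] assms(2) show False by simp
  qed
  then obtain j where "dot p (?r j) (?r j) \<noteq> 0" by auto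
  then have "dot p (?r j) (?r j) > 0"
    using dot_self_nonneg[of p "?r j"] by linarith
  with dot_resid_orthonormal[OF assms(1)] show ?thesis by blast
qed

text \<open>For \<open>k = p\<close> the trace is zero, so every standard unit vector has zero
  residual and equals its expansion in \<open>v\<close>; reading off coordinate \<open>b\<close> of
  the expansion of the \<open>a\<close>-th one gives the claim. In matrix terms, orthonormal rows
  force orthonormal columns.\<close>

lemma orthonormal_basis_columns:
  assumes "orthonormal p p v" "a < p" "b < p"
  shows "(\<Sum>i<p. v i a * v i b) = (if a = b then 1 else 0)"
proof -
  let ?e = "\<lambda>j a. if a = j then 1 else (0::real)"
  let ?r = "\<lambda>j. resid p p v (?e j)"
  have "(\<Sum>j<p. dot p (?r j) (?r j)) = 0"
    using sum_resid_unit_vectors[OF assms(1)] by simp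
  then have "dot p (?r a) (?r a) = 0"
    using assms by (subst (asm) sum_nonneg_eq_0_iff) (auto simp: dot_self_nonneg)
  then have "?r a b = 0" using assms by (simp add: dot_self_eq_0)
  then have "?e a b = (\<Sum>i<p. dot p (?e a) (v i) * v i b)"
    by (simp add: resid_def)
  also have "\<dots> = (\<Sum>i<p. v i a * v i b)"
    using assms by (simp add: dot_unit_right dot_commute[of p "?e a" "v _"])
  finally show ?thesis by (auto split: if_splits)
qed

section \<open>Eigenvectors as maximisers of the quadratic form\<close>

lemma linear_le_quadratic_imp_zero:
  fixes b c :: real
  assumes "\<And>t. 2 * t * b \<le> t\<^sup>2 * c"
  shows "b = 0"
proof (rule ccontr)
  assume b: "b \<noteq> 0"
  \<comment> \<open>For nonzero \<open>b\<close> the choice \<open>t = b / d\<close> turns the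
    assumption into \<open>2 * d \<le> c\<close>, which this \<open>d\<close> violates.\<close>
  define d where "d = \<bar>c\<bar> + 1"
  have d: "d > 0" "c < d * 2" by (auto simp: d_def)
  have "2 * (b / d) * b \<le> (b / d)\<^sup>2 * c" by (rule assms)
  then have "2 * b\<^sup>2 * d \<le> b\<^sup>2 * c"
    using d by (simp add: field_simps power2_eq_square)
  with b d show False by (simp add: mult.commute[of _ d] mult.left_commute)
qed

text \<open>The unit vectors orthogonal to the given ones form a nonempty compact set, on which the
  continuous quadratic form attains its maximum. Homogeneity of degree two extends the bound from
  unit vectors to all vectors of the complement.\<close>

lemma ex_max_quadratic_form:
  assumes orth: "orthonormal p k v" and "k < p"
  shows "\<exists>x. dot p x x = 1 \<and> (\<forall>i<k. dot p x (v i) = 0) \<and>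
    (\<forall>y. (\<forall>i<k. dot p y (v i) = 0) \<longrightarrow> dot p y (mulv p A y) \<le> dot p x (mulv p A x) * dot p y y)"
proof -
  \<comment> \<open>Pinning the coordinates from \<open>p\<close> on to \<open>0\<close> makes the
    box compact by Tychonoff; the interval \<open>{-1..1}\<close> holds every coordinate of a unit
    vector.\<close>
  define S where "S = (PiE UNIV (\<lambda>i. if i < p then {-1..1} else {0::real})) \<inter>
     ({x. dot p x x = 1} \<inter> (\<Inter>i\<in>{..<k}. {x. dot p x (v i) = 0}))"
  have "compactin (product_topology (\<lambda>i. euclidean) UNIV)
     (PiE UNIV (\<lambda>i. if i < p then {-1..1} else {0::real}))"
    by (simp add: compactin_PiE)
  then have comp: "compact (PiE UNIV (\<lambda>i. if i < p then {-1..1} else {0::real}))"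
    by (simp add: euclidean_product_topology)
  have cont: "continuous_on UNIV (\<lambda>x. dot p x (f x))"
    if "\<And>i. continuous_on UNIV (\<lambda>x. f x i)" for f
    unfolding dot_def by (intro continuous_intros that continuous_on_product_coordinates)
  have "closed ({x. dot p x x = 1} \<inter> (\<Inter>i\<in>{..<k}. {x. dot p x (v i) = 0}))"
    by (intro closed_Int closed_INT ballI closed_Collect_eq cont continuous_intros
        continuous_on_product_coordinates)
  with comp have "compact S" unfolding S_def by (rule compact_Int_closed)
  \<comment> \<open>The normalised vector is cut off beyond \<open>p\<close> to land in
    \<open>S\<close>, so it is proportional to \<open>y\<close> only below \<open>p\<close>, which
    is all that \<open>dot\<close> and \<open>mulv\<close> see.\<close>
  have normalize: "\<exists>z\<in>S. \<forall>a<p. y a = sqrt (dot p y y) * z a"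
    if y: "dot p y y > 0" "\<forall>i<k. dot p y (v i) = 0" for y
  proof
    let ?c = "1 / sqrt (dot p y y)"
    let ?z = "\<lambda>a. if a < p then ?c * y a else 0"
    have dz: "dot p ?z w = ?c * dot p y w" for w
      by (simp add: dot_def sum_distrib_left mult.assoc)
    have "dot p ?z ?z = ?c * (?c * dot p y y)"
      using dz[of ?z] dz[of y] dot_commute[of p y ?z] by simp
    also have "\<dots> = 1"
      using y(1) by (simp add: field_simps)
    finally have zz: "dot p ?z ?z = 1" .
    have "?z a \<in> {-1..1}" if "a < p" for a
    proof -
      have "(?z a)\<^sup>2 \<le> (\<Sum>i<p. (?z i)\<^sup>2)"
        using that by (intro member_le_sum) auto
      then have "\<bar>?z a\<bar> \<le> 1" using zz by (simp only: dot_self abs_square_le_1)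
      then show ?thesis by (simp add: abs_le_iff)
    qed
    with zz show "?z \<in> S"
      using y(2) unfolding S_def by (auto simp: dz)
    show "\<forall>a<p. y a = sqrt (dot p y y) * ?z a" using y(1) by simp
  qed
  from ex_orthogonal_vector[OF assms] normalize have "S \<noteq> {}" by blast
  moreover have "continuous_on S (\<lambda>x. dot p x (mulv p A x))"
    by (rule continuous_on_subset[OF cont])
      (auto simp: mulv_def intro!: continuous_intros continuous_on_product_coordinates)
  ultimately obtain x where x: "x \<in> S"
      "\<And>y. y \<in> S \<Longrightarrow> dot p y (mulv p A y) \<le> dot p x (mulv p A x)"
    using continuous_attains_sup[OF \<open>compact S\<close>] by metis
  have "dot p y (mulv p A y) \<le> dot p x (mulv p A x) * dot p y y"
    if y: "\<forall>i<k. dot p y (v i) = 0" for y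
  proof (cases "dot p y y = 0")
    case True
    then have "dot p y (mulv p A y) = 0"
      by (subst (asm) dot_self_eq_0) (simp add: dot_def)
    with True show ?thesis by simp
  next
    case False
    then have pos: "dot p y y > 0" using dot_self_nonneg[of p y] by simp
    with normalize y obtain z where z: "z \<in> S" "\<forall>a<p. y a = sqrt (dot p y y) * z a" by blast
    have "dot p y (mulv p A y) = (\<Sum>a<p. \<Sum>b<p. y a * (A a b * y b))"
      by (simp add: dot_def mulv_def sum_distrib_left)
    also have "\<dots> = (\<Sum>a<p. \<Sum>b<p. (sqrt (dot p y y))\<^sup>2 * (z a * (A a b * z b)))"
    proof (intro sum.cong refl)
      fix a b assume "a \<in> {..<p}" "b \<in> {..<p}"
      then have "y a = sqrt (dot p y y) * z a" "y b = sqrt (dot p y y) * z b" using z(2) by auto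
      then show "y a * (A a b * y b) = (sqrt (dot p y y))\<^sup>2 * (z a * (A a b * z b))"
        by (metis (no_types, lifting) mult.assoc mult.left_commute power2_eq_square)
    qed
    also have "\<dots> = (sqrt (dot p y y))\<^sup>2 * dot p z (mulv p A z)"
      by (simp add: dot_def mulv_def sum_distrib_left)
    also have "\<dots> = dot p y y * dot p z (mulv p A z)" using pos by simp
    also have "\<dots> \<le> dot p x (mulv p A x) * dot p y y"
      using x(2)[OF z(1)] pos by (simp add: mult.commute)
    finally show ?thesis .
  qed
  with x(1) show ?thesis unfolding S_def by blast
qed

text \<open>The orthogonal complement of eigenvectors is invariant under a symmetric matrix. At the
  maximiser \<open>x\<close> of the quadratic form, the defect of the eigenvalue equation is
  therefore an admissible direction of variation.\<close>

lemma ex_eigenvector_orthogonal: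
  assumes sym: "\<And>a b. a < p \<Longrightarrow> b < p \<Longrightarrow> A a b = A b a"
    and orth: "orthonormal p k v" and "k < p"
    and eig: "\<And>i a. i < k \<Longrightarrow> a < p \<Longrightarrow> mulv p A (v i) a = lam i * v i a"
  shows "\<exists>x l. dot p x x = 1 \<and> (\<forall>i<k. dot p x (v i) = 0) \<and> (\<forall>a<p. mulv p A x a = l * x a)"
proof -
  obtain x where x: "dot p x x = 1" "\<forall>i<k. dot p x (v i) = 0"
    and max: "\<And>y. \<forall>i<k. dot p y (v i) = 0 \<Longrightarrow>
        dot p y (mulv p A y) \<le> dot p x (mulv p A x) * dot p y y"
    using ex_max_quadratic_form[OF orth \<open>k < p\<close>, of A] by blast
  define l where "l = dot p x (mulv p A x)"
  \<comment> \<open>Maximality of \<open>l\<close> to first order in the direction \<open>w\<close> forces \<open>w = 0\<close>.\<close>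
  define w where "w = (\<lambda>a. mulv p A x a - l * x a)"
  have wv: "dot p w (v i) = 0" if "i < k" for i
  proof -
    have "dot p w (v i) = dot p (mulv p A x) (v i) - l * dot p x (v i)"
      by (simp add: w_def dot_diff_left dot_scale_left)
    also have "dot p (mulv p A x) (v i) = dot p x (mulv p A (v i))"
      using dot_mulv_commute[of p A x "v i"] sym by simp
    also have "\<dots> = lam i * dot p x (v i)"
      using eig[OF that] by (simp add: dot_def sum_distrib_left mult_ac)
    finally show ?thesis using x(2) that by simp
  qed
  have wx: "dot p w x = 0"
    using x(1) by (simp add: w_def dot_diff_left dot_scale_left l_def dot_commute[of p "mulv p A x"])
  have ww: "dot p w (mulv p A x) = dot p w w"
  proof -
    have "dot p w w = dot p (mulv p A x) w - l * dot p x w"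
      by (subst (2) w_def) (simp add: dot_commute[of p w] dot_diff_left dot_scale_left)
    then show ?thesis using wx by (simp add: dot_commute)
  qed
  \<comment> \<open>Maximality is applied to \<open>x + t * w\<close>. As \<open>w\<close> is
    orthogonal to \<open>x\<close>, the squared length is \<open>1 + t^2 * dot p w w\<close>, and
    the two cross terms of the quadratic form both equal \<open>t * dot p w w\<close>.\<close>
  have "2 * t * dot p w w \<le> t\<^sup>2 * (l * dot p w w - dot p w (mulv p A w))" for t
  proof -
    let ?y = "\<lambda>a. x a + t * w a"
    have lin: "mulv p A ?y = (\<lambda>a. mulv p A x a + t * mulv p A w a)"
      by (auto simp: mulv_def sum.distrib sum_distrib_left algebra_simps)
    have "\<forall>i<k. dot p ?y (v i) = 0"
      using x(2) wv by (simp add: dot_add_left dot_scale_left)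
    from max[OF this] have "dot p ?y (mulv p A ?y) \<le> l * dot p ?y ?y" by (simp add: l_def)
    moreover have "dot p ?y ?y = 1 + t\<^sup>2 * dot p w w"
    proof -
      have "dot p ?y ?y = dot p x x + 2 * t * dot p w x + t\<^sup>2 * dot p w w"
        by (simp add: dot_def sum.distrib sum_distrib_left algebra_simps power2_eq_square)
      then show ?thesis using wx x(1) by simp
    qed
    moreover have "dot p ?y (mulv p A ?y)
        = l + t * dot p w (mulv p A x) + t * dot p x (mulv p A w) + t\<^sup>2 * dot p w (mulv p A w)"
      unfolding lin l_def
      by (simp add: dot_def sum.distrib sum_distrib_left algebra_simps power2_eq_square)
    moreover have "dot p x (mulv p A w) = dot p w (mulv p A x)"
      using dot_mulv_commute[of p A x w] sym by (simp add: dot_commute)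
    ultimately show ?thesis using ww by (simp add: algebra_simps)
  qed
  then have "dot p w w = 0" by (rule linear_le_quadratic_imp_zero)
  then have "\<forall>a<p. mulv p A x a = l * x a" by (simp add: dot_self_eq_0 w_def)
  with x show ?thesis by blast
qed

lemma ex_orthonormal_eigenvectors:
  assumes sym: "\<And>a b. a < p \<Longrightarrow> b < p \<Longrightarrow> A a b = A b a"
  shows "k \<le> p \<Longrightarrow> \<exists>v lam. orthonormal p k v \<and> (\<forall>i<k. \<forall>a<p. mulv p A (v i) a = lam i * v i a)"
proof (induction k)
  case 0
  then show ?case by (simp add: orthonormal_def)
next
  case (Suc k)
  then obtain v lam where v: "orthonormal p k v" "\<forall>i<k. \<forall>a<p. mulv p A (v i) a = lam i * v i a"
    by auto
  with ex_eigenvector_orthogonal[of p A k v lam] sym Suc.prems obtain x l where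
    x: "dot p x x = 1" "\<forall>i<k. dot p x (v i) = 0" "\<forall>a<p. mulv p A x a = l * x a"
    by (metis Suc_le_lessD)
  have "orthonormal p (Suc k) (v(k := x))"
    using v(1) x(1,2) by (auto simp: orthonormal_def less_Suc_eq dot_commute[of p "v _" x])
  moreover have "\<forall>i<Suc k. \<forall>a<p. mulv p A ((v(k := x)) i) a = (lam(k := l)) i * (v(k := x)) i a"
    using v(2) x(3) by (auto simp: less_Suc_eq)
  ultimately show ?case by blast
qed

text \<open>Each \<open>lam i * v i a\<close> is coordinate \<open>a\<close> of the matrix applied
  to \<open>v i\<close>, and the rank-one matrices of a full orthonormal system add up to the
  identity by \<open>orthonormal_basis_columns\<close>.\<close>

lemma ex_eigendecomposition:
  assumes sym: "\<And>a b. a < p \<Longrightarrow> b < p \<Longrightarrow> A a b = A b a"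
  shows "\<exists>v lam. orthonormal p p v \<and> (\<forall>a<p. \<forall>b<p. A a b = (\<Sum>i<p. lam i * v i a * v i b))"
proof -
  obtain v lam where v: "orthonormal p p v" "\<forall>i<p. \<forall>a<p. mulv p A (v i) a = lam i * v i a"
    using ex_orthonormal_eigenvectors[of p A p] sym by auto
  have "A a b = (\<Sum>i<p. lam i * v i a * v i b)" if ab: "a < p" "b < p" for a b
  proof -
    have "(\<Sum>i<p. lam i * v i a * v i b) = (\<Sum>i<p. mulv p A (v i) a * v i b)"
      using v(2) ab by simp
    also have "\<dots> = (\<Sum>i<p. \<Sum>c<p. A a c * v i c * v i b)"
      by (simp add: mulv_def sum_distrib_right)
    also have "\<dots> = (\<Sum>c<p. A a c * (\<Sum>i<p. v i c * v i b))"
      by (subst sum.swap) (simp add: sum_distrib_left mult.assoc)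
    also have "\<dots> = (\<Sum>c<p. if c = b then A a c else 0)"
      using orthonormal_basis_columns[OF v(1)] ab by (intro sum.cong) auto
    also have "\<dots> = A a b" using ab by simp
    finally show ?thesis by simp
  qed
  with v(1) show ?thesis by blast
qed

section \<open>Spectral norm\<close>

lemma spec_norm_alt:
  "spec_norm p A = (SUP x\<in>{x. dot p x x = 1}. L2_set (mulv p A x) {..<p})"
  by (simp add: spec_norm_def dot_self L2_set_def mulv_def)

text \<open>Cauchy-Schwarz in each row. Besides the Frobenius bound this shows that the supremum in
  \<open>spec_norm\<close> is over a bounded set, without which \<open>spec_norm_upper\<close> could
  not be concluded.\<close>

lemma L2_set_mulv_le_Frobenius:
  assumes "dot p x x = 1"
  shows "(L2_set (mulv p A x) {..<p})\<^sup>2 \<le> (\<Sum>a<p. \<Sum>b<p. (A a b)\<^sup>2)"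
proof -
  have "(L2_set (mulv p A x) {..<p})\<^sup>2 = (\<Sum>a<p. (mulv p A x a)\<^sup>2)"
    by (simp add: L2_set_def sum_nonneg)
  also have "\<dots> \<le> (\<Sum>a<p. \<Sum>b<p. (A a b)\<^sup>2)"
    using dot_Cauchy_Schwarz[of p "A _" x] assms
    by (intro sum_mono) (simp add: mulv_def dot_def power2_eq_square)
  finally show ?thesis .
qed

lemma spec_norm_upper:
  assumes "dot p x x = 1"
  shows "L2_set (mulv p A x) {..<p} \<le> spec_norm p A"
  unfolding spec_norm_alt
proof (rule cSUP_upper)
  show "bdd_above ((\<lambda>x. L2_set (mulv p A x) {..<p}) ` {x. dot p x x = 1})"
    using L2_set_mulv_le_Frobenius real_le_rsqrt by (auto simp: bdd_above_def) blast
qed (use assms in simp)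

lemma spec_norm_least:
  assumes "0 < p" "\<And>x. dot p x x = 1 \<Longrightarrow> L2_set (mulv p A x) {..<p} \<le> c"
  shows "spec_norm p A \<le> c"
  unfolding spec_norm_alt
proof (rule cSUP_least)
  \<comment> \<open>A conditionally complete supremum needs a nonempty index set; the first standard
    unit vector exists because \<open>0 < p\<close>.\<close>
  have "dot p (\<lambda>i. if i = 0 then 1 else 0) (\<lambda>i. if i = 0 then 1 else 0) = 1"
    using assms(1) by (simp add: dot_unit_right)
  then show "{x. dot p x x = 1} \<noteq> {}" by blast
qed (use assms in simp)

lemma spec_norm_nonneg:
  assumes "0 < p" shows "0 \<le> spec_norm p A"
proof -
  have "dot p (\<lambda>i. if i = 0 then 1 else 0) (\<lambda>i. if i = 0 then 1 else 0) = 1"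
    using assms by (simp add: dot_unit_right)
  from spec_norm_upper[OF this, of A] show ?thesis
    by (rule order_trans[OF L2_set_nonneg])
qed

lemma spec_norm_le_Frobenius:
  assumes "0 < p"
  shows "(spec_norm p A)\<^sup>2 \<le> (\<Sum>a<p. \<Sum>b<p. (A a b)\<^sup>2)"
proof -
  have "spec_norm p A \<le> sqrt (\<Sum>a<p. \<Sum>b<p. (A a b)\<^sup>2)"
    using L2_set_mulv_le_Frobenius by (intro spec_norm_least[OF assms] real_le_rsqrt)
  then have "(spec_norm p A)\<^sup>2 \<le> (sqrt (\<Sum>a<p. \<Sum>b<p. (A a b)\<^sup>2))\<^sup>2"
    by (intro power_mono spec_norm_nonneg assms)
  then show ?thesis by (simp add: sum_nonneg)
qed

text \<open>Schur test: weighted Cauchy-Schwarz with weights \<open>\<bar>A a b\<bar>\<close> costs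
  one factor \<open>c\<close> for the sum over \<open>b\<close>, and exchanging the sums costs a
  second one for the sum over \<open>a\<close>. By symmetry, row and column sums share the bound
  \<open>c\<close>.\<close>

lemma spec_norm_Schur_test:
  assumes "0 < p" "0 \<le> c"
    and symA: "\<And>a b. a < p \<Longrightarrow> b < p \<Longrightarrow> A a b = A b a"
    and row: "\<And>b. b < p \<Longrightarrow> (\<Sum>a<p. \<bar>A a b\<bar>) \<le> c"
  shows "spec_norm p A \<le> c"
proof (rule spec_norm_least[OF \<open>0 < p\<close>])
  fix x assume x: "dot p x x = 1"
  have pt: "(mulv p A x a)\<^sup>2 \<le> c * (\<Sum>b<p. \<bar>A a b\<bar> * (x b)\<^sup>2)" if a: "a < p" for a
  proof -
    have "(mulv p A x a)\<^sup>2 = (\<Sum>b<p. sqrt \<bar>A a b\<bar> * (sgn (A a b) * sqrt \<bar>A a b\<bar> * x b))\<^sup>2"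
    proof -
      have "A a b * x b = sqrt \<bar>A a b\<bar> * (sgn (A a b) * sqrt \<bar>A a b\<bar> * x b)" for b
      proof -
        have "sqrt \<bar>A a b\<bar> * (sgn (A a b) * sqrt \<bar>A a b\<bar> * x b)
            = (sqrt \<bar>A a b\<bar> * sqrt \<bar>A a b\<bar>) * sgn (A a b) * x b" by (simp only: mult_ac)
        also have "\<dots> = A a b * x b" by (simp add: abs_mult_sgn)
        finally show ?thesis by (rule sym)
      qed
      then show ?thesis
        unfolding mulv_def by (intro arg_cong[where f="\<lambda>s. s\<^sup>2"] sum.cong refl)
    qed
    also have "\<dots> \<le> (\<Sum>b<p. (sqrt \<bar>A a b\<bar>)\<^sup>2) * (\<Sum>b<p. (sgn (A a b) * sqrt \<bar>A a b\<bar> * x b)\<^sup>2)"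
      by (rule Cauchy_Schwarz_ineq_sum)
    also have "(\<Sum>b<p. (sgn (A a b) * sqrt \<bar>A a b\<bar> * x b)\<^sup>2) = (\<Sum>b<p. \<bar>A a b\<bar> * (x b)\<^sup>2)"
      by (intro sum.cong refl) (simp add: power_mult_distrib sgn_if)
    also have "(\<Sum>b<p. (sqrt \<bar>A a b\<bar>)\<^sup>2) = (\<Sum>b<p. \<bar>A b a\<bar>)"
      using symA a by (intro sum.cong) auto
    also have "\<dots> * (\<Sum>b<p. \<bar>A a b\<bar> * (x b)\<^sup>2) \<le> c * (\<Sum>b<p. \<bar>A a b\<bar> * (x b)\<^sup>2)"
      using row[OF a] by (intro mult_right_mono sum_nonneg) auto
    finally show ?thesis .
  qed
  have "(\<Sum>a<p. (mulv p A x a)\<^sup>2) \<le> (\<Sum>a<p. c * (\<Sum>b<p. \<bar>A a b\<bar> * (x b)\<^sup>2))"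
    using pt by (intro sum_mono) auto
  also have "\<dots> = c * (\<Sum>b<p. (\<Sum>a<p. \<bar>A a b\<bar>) * (x b)\<^sup>2)"
    by (simp add: sum_distrib_left[symmetric] sum_distrib_right) (subst sum.swap, simp)
  also have "\<dots> \<le> c * (\<Sum>b<p. c * (x b)\<^sup>2)"
    using row \<open>0 \<le> c\<close> by (intro mult_left_mono sum_mono mult_right_mono) auto
  also have "\<dots> = c\<^sup>2"
    using x by (simp add: sum_distrib_left[symmetric] dot_self power2_eq_square)
  finally show "L2_set (mulv p A x) {..<p} \<le> c"
    unfolding L2_set_def using \<open>0 \<le> c\<close> by (intro real_le_lsqrt) (auto intro: sum_nonneg)
qed

section \<open>Spectral norm error of the positive semidefinite part\<close>

lemma abs_quadratic_form_le_spec_norm: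
  assumes "dot p x x = 1"
  shows "\<bar>dot p x (mulv p A x)\<bar> \<le> spec_norm p A"
proof -
  have "(dot p x (mulv p A x))\<^sup>2 \<le> (L2_set (mulv p A x) {..<p})\<^sup>2"
    using dot_Cauchy_Schwarz[of p x "mulv p A x"] assms
    by (simp add: L2_set_def sum_nonneg dot_self)
  then have "\<bar>dot p x (mulv p A x)\<bar> \<le> L2_set (mulv p A x) {..<p}"
    by (simp add: abs_le_square_iff[symmetric] L2_set_nonneg)
  with spec_norm_upper[OF assms, of A] show ?thesis by linarith
qed

lemma dot_self_orthonormal_combination:
  assumes "orthonormal p k v"
  shows "dot p (\<lambda>a. \<Sum>i<k. c i * v i a) (\<lambda>a. \<Sum>i<k. c i * v i a) = (\<Sum>i<k. (c i)\<^sup>2)"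
proof -
  let ?u = "\<lambda>a. \<Sum>i<k. c i * v i a"
  have "dot p ?u ?u = (\<Sum>i<k. c i * dot p ?u (v i))"
    by (subst dot_sum_left) (simp add: dot_scale_left dot_commute[of p "v _" ?u])
  also have "\<dots> = (\<Sum>i<k. c i * (\<Sum>j<k. c j * dot p (v j) (v i)))"
    by (simp add: dot_sum_left dot_scale_left)
  also have "\<dots> = (\<Sum>i<k. c i * (\<Sum>j<k. if j = i then c j else 0))"
    using assms by (intro sum.cong refl arg_cong2[where f="(*)"]) (auto simp: orthonormal_def)
  finally show ?thesis by (simp add: power2_eq_square)
qed

lemma mulv_rank_one_sum:
  assumes "a < p" "\<And>a b. a < p \<Longrightarrow> b < p \<Longrightarrow> A a b = (\<Sum>i<p. d i * v i a * v i b)"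
  shows "mulv p A x a = (\<Sum>i<p. (d i * dot p x (v i)) * v i a)"
proof -
  have "mulv p A x a = (\<Sum>b<p. \<Sum>i<p. d i * v i a * v i b * x b)"
    using assms by (simp add: mulv_def sum_distrib_right)
  also have "\<dots> = (\<Sum>i<p. \<Sum>b<p. d i * v i a * v i b * x b)"
    by (rule sum.swap)
  also have "\<dots> = (\<Sum>i<p. (d i * dot p x (v i)) * v i a)"
    by (simp add: dot_def sum_distrib_left sum_distrib_right mult_ac)
  finally show ?thesis .
qed

text \<open>\<open>lam i\<close> is the quadratic form of \<open>A\<close> at \<open>v i\<close>. As
  that of \<open>B\<close> is nonnegative, \<open>lam i\<close> is at least the quadratic form of
  the difference, hence at least minus its spectral norm. So the correction from \<open>A\<close> to
  \<open>psd_part p A\<close> has spectral norm at most that of the difference, and the triangle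
  inequality gives the factor 2.\<close>

lemma spec_norm_psd_part_le:
  assumes "0 < p"
    and sym: "\<And>a b. a < p \<Longrightarrow> b < p \<Longrightarrow> A a b = A b a"
    and psd: "\<And>x. 0 \<le> dot p x (mulv p B x)"
  shows "spec_norm p (\<lambda>a b. psd_part p A a b - B a b) \<le> 2 * spec_norm p (\<lambda>a b. A a b - B a b)"
proof -
  let ?m = "spec_norm p (\<lambda>a b. A a b - B a b)"
  let ?P = "\<lambda>M. \<exists>(v :: nat \<Rightarrow> nat \<Rightarrow> real) (lam :: nat \<Rightarrow> real).
      (\<forall>i<p. \<forall>j<p. (\<Sum>k<p. v i k * v j k) = (if i = j then 1 else 0)) \<and>
      (\<forall>a<p. \<forall>b<p. A a b = (\<Sum>i<p. lam i * v i a * v i b)) \<and>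
      M = (\<lambda>a b. if a < p \<and> b < p then (\<Sum>i<p. max (lam i) 0 * v i a * v i b) else 0)"
  \<comment> \<open>\<open>psd_part\<close> is a Hilbert choice, so it is usable only once some
    eigendecomposition exists; the argument then works for whichever one was chosen.\<close>
  from ex_eigendecomposition[of p A] sym have "\<exists>M. ?P M"
    unfolding orthonormal_def dot_def by blast
  then have "?P (psd_part p A)" unfolding psd_part_def by (rule someI_ex)
  then obtain v lam where
    v: "orthonormal p p v" and A: "\<And>a b. a < p \<Longrightarrow> b < p \<Longrightarrow> A a b = (\<Sum>i<p. lam i * v i a * v i b)"
    and M: "psd_part p A = (\<lambda>a b. if a < p \<and> b < p then (\<Sum>i<p. max (lam i) 0 * v i a * v i b) else 0)"
    unfolding orthonormal_def dot_def by blast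
  \<comment> \<open>The negative parts of the eigenvalues, which are the eigenvalues of
    \<open>psd_part p A\<close> minus \<open>A\<close>.\<close>
  define d where "d i = max (lam i) 0 - lam i" for i
  have d: "0 \<le> d i" "d i \<le> ?m" if i: "i < p" for i
  proof -
    have vi: "dot p (v i) (v i) = 1" using v i by (simp add: orthonormal_def)
    have "dot p (v i) (mulv p A (v i)) = dot p (v i) (\<lambda>a. \<Sum>j<p. (lam j * dot p (v i) (v j)) * v j a)"
      unfolding dot_def using mulv_rank_one_sum[OF _ A, where x="v i"]
      by (intro sum.cong) (auto simp: dot_def)
    also have "\<dots> = (\<Sum>j<p. lam j * dot p (v i) (v j) * dot p (v j) (v i))"
      by (subst dot_commute) (simp add: dot_sum_left dot_scale_left)
    also have "\<dots> = (\<Sum>j<p. if j = i then lam j else 0)"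
      using v i by (intro sum.cong) (auto simp: orthonormal_def)
    also have "\<dots> = lam i" using i by simp
    finally have "dot p (v i) (mulv p (\<lambda>a b. A a b - B a b) (v i)) = lam i - dot p (v i) (mulv p B (v i))"
      by (simp add: mulv_def dot_def sum_subtractf left_diff_distrib right_diff_distrib)
    with abs_quadratic_form_le_spec_norm[OF vi, of "\<lambda>a b. A a b - B a b"] psd[of "v i"]
    have "- lam i \<le> ?m" by linarith
    with spec_norm_nonneg[OF \<open>0 < p\<close>] show "0 \<le> d i" "d i \<le> ?m" by (auto simp: d_def max_def)
  qed
  show ?thesis
  proof (rule spec_norm_least[OF \<open>0 < p\<close>])
    fix x assume x: "dot p x x = 1"
    let ?D = "\<lambda>a b. psd_part p A a b - A a b"
    have D: "?D a b = (\<Sum>i<p. d i * v i a * v i b)" if "a < p" "b < p" for a b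
      using that by (simp add: M A d_def sum_subtractf left_diff_distrib)
    have "mulv p ?D x a = (\<Sum>i<p. (d i * dot p x (v i)) * v i a)" if "a < p" for a
      using mulv_rank_one_sum[of a p ?D d v x] D that by blast
    then have "(\<Sum>a<p. (mulv p ?D x a)\<^sup>2)
        = dot p (\<lambda>a. \<Sum>i<p. (d i * dot p x (v i)) * v i a) (\<lambda>a. \<Sum>i<p. (d i * dot p x (v i)) * v i a)"
      unfolding dot_self by (intro sum.cong) auto
    also have "\<dots> = (\<Sum>i<p. (d i * dot p x (v i))\<^sup>2)"
      by (rule dot_self_orthonormal_combination[OF v])
    also have "\<dots> \<le> (\<Sum>i<p. ?m\<^sup>2 * (dot p x (v i))\<^sup>2)"
      using d by (intro sum_mono) (auto simp: power_mult_distrib intro!: mult_right_mono power_mono)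
    also have "\<dots> \<le> ?m\<^sup>2"
      using Bessel_inequality[OF v, of x] x
      by (simp add: sum_distrib_left[symmetric] mult_left_le)
    finally have "L2_set (mulv p ?D x) {..<p} \<le> ?m"
      unfolding L2_set_def using spec_norm_nonneg[OF \<open>0 < p\<close>]
      by (intro real_le_lsqrt) (auto intro: sum_nonneg)
    moreover have "L2_set (mulv p (\<lambda>a b. A a b - B a b) x) {..<p} \<le> ?m"
      by (rule spec_norm_upper[OF x])
    moreover have "mulv p (\<lambda>a b. psd_part p A a b - B a b) x
        = (\<lambda>a. mulv p ?D x a + mulv p (\<lambda>a b. A a b - B a b) x a)"
      by (auto simp: mulv_def sum.distrib[symmetric] algebra_simps)
    ultimately show "L2_set (mulv p (\<lambda>a b. psd_part p A a b - B a b) x) {..<p} \<le> 2 * ?m"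
      using L2_set_triangle_ineq[of "mulv p ?D x" "mulv p (\<lambda>a b. A a b - B a b) x" "{..<p}"]
      by simp
  qed
qed

section \<open>Gaussian noise\<close>

text \<open>The exponent comes from comparing with the normal density of standard deviation \<open>2\<sigma>\<close>.\<close>

lemma normal_density_tail:
  assumes "0 < \<sigma>" "0 \<le> t"
  shows "measure (density lborel (normal_density 0 \<sigma>)) {x. \<bar>x\<bar> > t} \<le> 2 * exp (- 3 * t\<^sup>2 / (8 * \<sigma>\<^sup>2))"
proof -
  let ?c = "2 * exp (- 3 * t\<^sup>2 / (8 * \<sigma>\<^sup>2))"
  have pt: "normal_density 0 \<sigma> x \<le> ?c * normal_density 0 (2 * \<sigma>) x" if "\<bar>x\<bar> > t" for x
  proof -
    have sq: "t\<^sup>2 \<le> x\<^sup>2" using that assms by (simp add: abs_le_square_iff[symmetric])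
    have "exp (- x\<^sup>2 / (2 * \<sigma>\<^sup>2)) \<le> exp (- 3 * t\<^sup>2 / (8 * \<sigma>\<^sup>2) + (- x\<^sup>2 / (8 * \<sigma>\<^sup>2)))"
      using sq assms by (simp add: field_simps)
    also have "\<dots> = exp (- 3 * t\<^sup>2 / (8 * \<sigma>\<^sup>2)) * exp (- x\<^sup>2 / (8 * \<sigma>\<^sup>2))"
      by (rule exp_add)
    finally have "exp (- x\<^sup>2 / (2 * \<sigma>\<^sup>2)) / sqrt (2 * pi * \<sigma>\<^sup>2)
       \<le> exp (- 3 * t\<^sup>2 / (8 * \<sigma>\<^sup>2)) * exp (- x\<^sup>2 / (8 * \<sigma>\<^sup>2)) / sqrt (2 * pi * \<sigma>\<^sup>2)"
      by (intro divide_right_mono) auto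
    \<comment> \<open>The ratio of the two normalising constants is the factor 2 in front of the
      tail bound.\<close>
    moreover have "sqrt (2 * pi * (2 * \<sigma>)\<^sup>2) = 2 * sqrt (2 * pi * \<sigma>\<^sup>2)"
    proof -
      have "2 * pi * (2 * \<sigma>)\<^sup>2 = 2\<^sup>2 * (2 * pi * \<sigma>\<^sup>2)" by (simp add: power_mult_distrib)
      then show ?thesis by (simp only: real_sqrt_mult[of "2\<^sup>2"] real_sqrt_abs abs_numeral)
    qed
    ultimately show ?thesis
      by (simp add: normal_density_def power_mult_distrib)
  qed
  have "emeasure (density lborel (normal_density 0 \<sigma>)) {x. \<bar>x\<bar> > t}
      = (\<integral>\<^sup>+x. ennreal (normal_density 0 \<sigma> x) * indicator {x. \<bar>x\<bar> > t} x \<partial>lborel)"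
    by (rule emeasure_density) auto
  also have "\<dots> \<le> (\<integral>\<^sup>+x. ennreal (?c * normal_density 0 (2 * \<sigma>) x) \<partial>lborel)"
    using pt by (intro nn_integral_mono) (auto simp: indicator_def intro!: ennreal_leI)
  also have "\<dots> = ennreal (\<integral>x. ?c * normal_density 0 (2 * \<sigma>) x \<partial>lborel)"
    using assms by (intro nn_integral_eq_integral) auto
  also have "\<dots> = ennreal ?c" using assms by simp
  finally show ?thesis
    unfolding measure_def by (metis enn2real_leI less_eq_real_def exp_gt_zero mult_pos_pos zero_less_numeral)
qed

lemma normal_fourth_moment:
  assumes "0 < \<sigma>"
  shows "integrable (density lborel (normal_density 0 \<sigma>)) (\<lambda>x. x ^ 4)"
    and "(\<integral>x. x ^ 4 \<partial>density lborel (normal_density 0 \<sigma>)) = 3 * \<sigma> ^ 4"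
proof -
  \<comment> \<open>The even moment formula at \<open>k = 2\<close>:
    \<open>4! / ((2 / \<sigma>^2)^2 * 2!) = 3 * \<sigma>^4\<close>.\<close>
  have "has_bochner_integral lborel (\<lambda>x. normal_density 0 \<sigma> x * x ^ 4) (3 * \<sigma> ^ 4)"
    using normal_moment_even[OF assms, of 0 2] assms
    by (simp add: fact_numeral power_divide field_simps)
  then show "integrable (density lborel (normal_density 0 \<sigma>)) (\<lambda>x. x ^ 4)"
    and "(\<integral>x. x ^ 4 \<partial>density lborel (normal_density 0 \<sigma>)) = 3 * \<sigma> ^ 4"
    by (auto simp: integrable_density integral_density has_bochner_integral_iff)
qed

section \<open>Marginals of a product of two probability spaces\<close>

lemma distr_pair_snd:
  assumes "prob_space M" "sigma_finite_measure N"
  shows "distr (M \<Otimes>\<^sub>M N) N snd = N"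
proof (rule measure_eqI)
  interpret M: prob_space M by fact
  interpret N: sigma_finite_measure N by fact
  fix A assume "A \<in> sets (distr (M \<Otimes>\<^sub>M N) N snd)"
  then have A: "A \<in> sets N" by simp
  have "snd -` A \<inter> space (M \<Otimes>\<^sub>M N) = space M \<times> A"
    using sets.sets_into_space[OF A] by (auto simp: space_pair_measure)
  with A show "emeasure (distr (M \<Otimes>\<^sub>M N) N snd) A = emeasure N A"
    by (simp add: emeasure_distr N.emeasure_pair_measure_Times M.emeasure_space_1)
qed simp

lemma
  fixes f :: "_ \<Rightarrow> real"
  assumes "prob_space M" "prob_space N" "integrable M f"
  shows integrable_pair_fst: "integrable (M \<Otimes>\<^sub>M N) (\<lambda>\<omega>. f (fst \<omega>))"
    and integral_pair_fst: "(\<integral>\<omega>. f (fst \<omega>) \<partial>(M \<Otimes>\<^sub>M N)) = (\<integral>x. f x \<partial>M)"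
proof -
  have d: "distr (M \<Otimes>\<^sub>M N) M fst = M" using assms(2) by (rule prob_space.distr_pair_fst)
  have f: "f \<in> borel_measurable M" using assms(3) by simp
  show "integrable (M \<Otimes>\<^sub>M N) (\<lambda>\<omega>. f (fst \<omega>))"
    using integrable_distr_eq[OF measurable_fst f] assms(3) d by metis
  show "(\<integral>\<omega>. f (fst \<omega>) \<partial>(M \<Otimes>\<^sub>M N)) = (\<integral>x. f x \<partial>M)"
    using integral_distr[OF measurable_fst f] d by metis
qed

lemma
  fixes f :: "_ \<Rightarrow> real"
  assumes "prob_space M" "prob_space N" "integrable N f"
  shows integrable_pair_snd: "integrable (M \<Otimes>\<^sub>M N) (\<lambda>\<omega>. f (snd \<omega>))"
    and integral_pair_snd: "(\<integral>\<omega>. f (snd \<omega>) \<partial>(M \<Otimes>\<^sub>M N)) = (\<integral>x. f x \<partial>N)"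
proof -
  have d: "distr (M \<Otimes>\<^sub>M N) N snd = N"
    using assms(1,2) by (intro distr_pair_snd prob_space_imp_sigma_finite)
  have f: "f \<in> borel_measurable N" using assms(3) by simp
  show "integrable (M \<Otimes>\<^sub>M N) (\<lambda>\<omega>. f (snd \<omega>))"
    using integrable_distr_eq[OF measurable_snd f] assms(3) d by metis
  show "(\<integral>\<omega>. f (snd \<omega>) \<partial>(M \<Otimes>\<^sub>M N)) = (\<integral>x. f x \<partial>N)"
    using integral_distr[OF measurable_snd f] d by metis
qed

section \<open>Distribution of the entries of the noise matrix\<close>

lemma prob_space_noise_space: "0 < \<sigma> \<Longrightarrow> prob_space (noise_space p \<sigma>)"
  unfolding noise_space_def by (intro prob_space_PiM prob_space_normal_density)

lemma
  assumes "a < p" "b < p"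
  shows measurable_sym_noise: "(\<lambda>z. sym_noise z a b) \<in> borel_measurable (noise_space p \<sigma>)"
    and distr_sym_noise: "0 < \<sigma> \<Longrightarrow> distr (noise_space p \<sigma>) borel (\<lambda>z. sym_noise z a b)
           = density lborel (normal_density 0 \<sigma>)"
proof -
  let ?N = "density lborel (\<lambda>x. ennreal (normal_density 0 \<sigma> x))"
  \<comment> \<open>Every entry of the symmetric matrix, on either side of the diagonal, is a single
    coordinate of the product space, hence a centred Gaussian with standard deviation
    \<open>\<sigma>\<close>.\<close>
  let ?i = "if a \<le> b then (a, b) else (b, a)"
  have i: "?i \<in> upper_idx p" using assms by (auto simp: upper_idx_def)
  have eq: "(\<lambda>z. sym_noise z a b) = (\<lambda>z. z ?i)" by (auto simp: sym_noise_def)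
  have "(\<lambda>z. z ?i) \<in> measurable (noise_space p \<sigma>) ?N"
    unfolding noise_space_def using i by (rule measurable_component_singleton)
  then show "(\<lambda>z. sym_noise z a b) \<in> borel_measurable (noise_space p \<sigma>)"
    unfolding eq by (subst (asm) measurable_cong_sets[where N'=borel]) auto
  assume "0 < \<sigma>"
  then have "distr (noise_space p \<sigma>) ?N (\<lambda>z. z ?i) = ?N"
    unfolding noise_space_def using i
    by (intro distr_PiM_component[where M="\<lambda>_. ?N"]) (auto intro: prob_space_normal_density)
  then show "distr (noise_space p \<sigma>) borel (\<lambda>z. sym_noise z a b) = ?N"
    unfolding eq by (metis distr_cong sets_density sets_lborel)
qed

lemma sym_noise_tail:
  assumes "a < p" "b < p" "0 < \<sigma>" "0 \<le> t"
  shows "measure (noise_space p \<sigma>) {z \<in> space (noise_space p \<sigma>). \<bar>sym_noise z a b\<bar> > t}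
     \<le> 2 * exp (- 3 * t\<^sup>2 / (8 * \<sigma>\<^sup>2))"
proof -
  have "measure (distr (noise_space p \<sigma>) borel (\<lambda>z. sym_noise z a b)) {x. \<bar>x\<bar> > t}
      = measure (noise_space p \<sigma>) {z \<in> space (noise_space p \<sigma>). \<bar>sym_noise z a b\<bar> > t}"
    by (subst measure_distr[OF measurable_sym_noise[OF assms(1,2)]])
      (auto intro!: arg_cong[where f="measure _"])
  with normal_density_tail[OF assms(3,4)] show ?thesis
    by (simp add: distr_sym_noise[OF assms(1-3)])
qed

lemma
  assumes "a < p" "b < p" "0 < \<sigma>"
  shows integrable_sym_noise_4: "integrable (noise_space p \<sigma>) (\<lambda>z. sym_noise z a b ^ 4)"
    and integral_sym_noise_4: "(\<integral>z. sym_noise z a b ^ 4 \<partial>noise_space p \<sigma>) = 3 * \<sigma> ^ 4"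
  using integrable_distr_eq[OF measurable_sym_noise[OF assms(1,2), of \<sigma>], of "\<lambda>x. x ^ 4"]
    integral_distr[OF measurable_sym_noise[OF assms(1,2), of \<sigma>], of "\<lambda>x. x ^ 4"]
    normal_fourth_moment[OF assms(3)]
  by (simp_all add: distr_sym_noise[OF assms])

section \<open>Thresholding error\<close>

text \<open>Where \<open>S\<close> vanishes, \<open>T\<close> is at most \<open>\<tau>\<close> in
  absolute value and is set to exactly 0. Elsewhere closeness and thresholding each cost at most
  \<open>\<tau>\<close>. The Schur test then needs only the number of nonzero entries per
  column.\<close>

lemma spec_norm_threshold_le:
  assumes "0 < p" "1 \<le> s" "0 \<le> \<tau>" "in_G0 p s S"
    and symS: "\<And>a b. a < p \<Longrightarrow> b < p \<Longrightarrow> S a b = S b a"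
    and symT: "\<And>a b. a < p \<Longrightarrow> b < p \<Longrightarrow> T a b = T b a"
    and close: "\<And>a b. a < p \<Longrightarrow> b < p \<Longrightarrow> \<bar>T a b - S a b\<bar> \<le> \<tau>"
  shows "spec_norm p (\<lambda>a b. threshold \<tau> T a b - S a b) \<le> 4 * real s * \<tau>"
proof (rule spec_norm_Schur_test[OF \<open>0 < p\<close>])
  show "0 \<le> 4 * real s * \<tau>" using assms(3) by simp
  show "threshold \<tau> T a b - S a b = threshold \<tau> T b a - S b a" if "a < p" "b < p" for a b
    using symS[OF that] symT[OF that] by (simp add: threshold_def)
  fix b assume b: "b < p"
  let ?J = "{a. a < p \<and> a \<noteq> b \<and> S a b \<noteq> 0}"
  \<comment> \<open>The diagonal index is always charged, since \<open>in_G0\<close> counts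
    off-diagonal entries only.\<close>
  have "(\<Sum>a<p. \<bar>threshold \<tau> T a b - S a b\<bar>) \<le> (\<Sum>a<p. if a \<in> insert b ?J then 2 * \<tau> else 0)"
  proof (rule sum_mono)
    fix a assume "a \<in> {..<p}"
    with close[of a b] b assms(3)
    show "\<bar>threshold \<tau> T a b - S a b\<bar> \<le> (if a \<in> insert b ?J then 2 * \<tau> else 0)"
      by (auto simp: threshold_def)
  qed
  also have "\<dots> = (\<Sum>a\<in>insert b ?J. 2 * \<tau>)"
  proof -
    have "{..<p} \<inter> insert b ?J = insert b ?J" using b by auto
    then show ?thesis unfolding sum.inter_restrict[OF finite_lessThan, symmetric] by simp
  qed
  also have "\<dots> = (real (card ?J) + 1) * (2 * \<tau>)"
    by (subst sum_constant, subst card_insert_disjoint) auto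
  \<comment> \<open>\<open>s + 1 \<le> 2 * s\<close> absorbs the diagonal entry.\<close>
  also have "\<dots> \<le> (real s + real s) * (2 * \<tau>)"
  proof (intro mult_right_mono add_mono)
    show "real (card ?J) \<le> real s" using assms(4) b by (simp add: in_G0_def)
  qed (use assms in auto)
  finally show "(\<Sum>a<p. \<bar>threshold \<tau> T a b - S a b\<bar>) \<le> 4 * real s * \<tau>" by simp
qed

text \<open>The bound for the bad event. AM-GM with weight \<open>l\<close> trades the squared noise
  for a constant plus a fourth power, so that only the constant has to be multiplied by the
  indicator of the bad event. This decouples the noise from that event, with no need for the joint
  distribution.\<close>

lemma spec_norm_threshold_crude:
  fixes S R Z :: "nat \<Rightarrow> nat \<Rightarrow> real"
  assumes "0 < p" "0 < l"
    and "\<And>a b. a < p \<Longrightarrow> b < p \<Longrightarrow> \<bar>S a b\<bar> \<le> 1"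
    and "\<And>a b. a < p \<Longrightarrow> b < p \<Longrightarrow> \<bar>R a b\<bar> \<le> 1"
  shows "(spec_norm p (\<lambda>a b. threshold \<tau> (\<lambda>a b. R a b + Z a b) a b - S a b))\<^sup>2
     \<le> (real p)\<^sup>2 * (8 + l) + (\<Sum>a<p. \<Sum>b<p. Z a b ^ 4 / l)"
proof -
  let ?T = "\<lambda>a b. threshold \<tau> (\<lambda>a b. R a b + Z a b) a b - S a b"
  have pt: "(?T a b)\<^sup>2 \<le> (8 + l) + Z a b ^ 4 / l" if ab: "a < p" "b < p" for a b
  proof -
    have "\<bar>?T a b\<bar> \<le> 2 + \<bar>Z a b\<bar>"
      using assms(3,4)[OF ab] by (auto simp: threshold_def)
    then have "(?T a b)\<^sup>2 \<le> (2 + \<bar>Z a b\<bar>)\<^sup>2"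
      by (simp add: abs_le_square_iff[symmetric])
    also have "\<dots> \<le> 8 + 2 * (Z a b)\<^sup>2"
      using sum_squares_bound[of 2 "\<bar>Z a b\<bar>"] by (simp add: power2_sum)
    \<comment> \<open>AM-GM for \<open>l\<close> and the squared noise entry, divided by
      \<open>l\<close>.\<close>
    also have "2 * (Z a b)\<^sup>2 \<le> l + Z a b ^ 4 / l"
    proof -
      have "2 * l * (Z a b)\<^sup>2 \<le> l\<^sup>2 + ((Z a b)\<^sup>2)\<^sup>2" by (rule sum_squares_bound)
      moreover have "((Z a b)\<^sup>2)\<^sup>2 = Z a b ^ 4" by (simp flip: power_mult)
      ultimately show ?thesis
        using assms(2) by (simp add: field_simps power2_eq_square)
    qed
    finally show ?thesis by simp
  qed
  have "(spec_norm p ?T)\<^sup>2 \<le> (\<Sum>a<p. \<Sum>b<p. (?T a b)\<^sup>2)"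
    by (rule spec_norm_le_Frobenius[OF \<open>0 < p\<close>])
  also have "\<dots> \<le> (\<Sum>a<p. \<Sum>b<p. (8 + l) + Z a b ^ 4 / l)"
    using pt by (intro sum_mono) auto
  also have "\<dots> = (real p)\<^sup>2 * (8 + l) + (\<Sum>a<p. \<Sum>b<p. Z a b ^ 4 / l)"
    by (simp add: sum.distrib power2_eq_square algebra_simps)
  finally show ?thesis .
qed

lemma sample_cov_commute: "sample_cov n X a b = sample_cov n X b a"
  by (simp add: sample_cov_def mult.commute)

lemma cov_mat_commute: "cov_mat D a b = cov_mat D b a"
  by (simp add: cov_mat_def mult.commute)

lemma sym_noise_commute: "sym_noise z a b = sym_noise z b a"
  by (auto simp: sym_noise_def)

section \<open>Covariance of bounded vectors\<close>

lemma abs_mult_le_1_of_norm_le_1: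
  fixes x :: "nat \<Rightarrow> real"
  assumes "(\<Sum>i<p. (x i)\<^sup>2) \<le> 1" "a < p" "b < p"
  shows "\<bar>x a * x b\<bar> \<le> 1"
proof -
  have "(x i)\<^sup>2 \<le> 1" if "i < p" for i
    using member_le_sum[of i "{..<p}" "\<lambda>i. (x i)\<^sup>2"] assms(1) that by simp
  then have "\<bar>x a\<bar> \<le> 1" "\<bar>x b\<bar> \<le> 1"
    using assms(2,3) by (auto simp: abs_square_le_1)
  then show ?thesis by (simp add: abs_mult mult_le_one)
qed

locale bounded_vector = prob_space D for D :: "(nat \<Rightarrow> real) measure" +
  fixes p :: nat
  assumes sets_D: "sets D = sets (PiM {..<p} (\<lambda>_. borel))"
    and norm_le_1: "AE x in D. (\<Sum>i<p. (x i)\<^sup>2) \<le> 1"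
begin

lemma measurable_coordinate: "a < p \<Longrightarrow> (\<lambda>x. x a) \<in> borel_measurable D"
  by (subst measurable_cong_sets[OF sets_D refl]) (rule measurable_component_singleton, simp)

lemma AE_product_le_1: "a < p \<Longrightarrow> b < p \<Longrightarrow> AE x in D. \<bar>x a * x b\<bar> \<le> 1"
  using norm_le_1 by eventually_elim (rule abs_mult_le_1_of_norm_le_1)

lemma integrable_product:
  assumes "a < p" "b < p"
  shows "integrable D (\<lambda>x. x a * x b)"
  using AE_product_le_1[OF assms] measurable_coordinate assms
  by (intro integrable_const_bound[where B=1]) auto

lemma abs_cov_mat_le_1:
  assumes "a < p" "b < p"
  shows "\<bar>cov_mat D a b\<bar> \<le> 1"
proof -
  have "\<bar>cov_mat D a b\<bar> \<le> (\<integral>x. \<bar>x a * x b\<bar> \<partial>D)"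
    unfolding cov_mat_def by (rule integral_abs_bound)
  also have "\<dots> \<le> (\<integral>x. 1 \<partial>D)"
    using AE_product_le_1[OF assms] integrable_product[OF assms] by (intro integral_mono_AE) auto
  finally show ?thesis by (simp add: prob_space)
qed

text \<open>The quadratic form at \<open>v\<close> is the expectation of the square of the inner
  product of \<open>v\<close> with the random vector.\<close>

lemma cov_mat_psd: "0 \<le> dot p v (mulv p (cov_mat D) v)"
proof -
  have "dot p v (mulv p (cov_mat D) v) = (\<Sum>a<p. \<Sum>b<p. \<integral>x. v a * v b * (x a * x b) \<partial>D)"
    by (simp add: dot_def mulv_def cov_mat_def sum_distrib_left) (simp add: mult_ac)
  also have "\<dots> = (\<integral>x. (\<Sum>a<p. \<Sum>b<p. v a * v b * (x a * x b)) \<partial>D)"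
    using integrable_product by (subst Bochner_Integration.integral_sum; (intro integrable_mult_right Bochner_Integration.integrable_sum)?) (auto intro!: sum.cong Bochner_Integration.integral_sum[symmetric])
  also have "\<dots> = (\<integral>x. (\<Sum>a<p. v a * x a)\<^sup>2 \<partial>D)"
    by (simp add: power2_eq_square sum_product mult_ac)
  also have "\<dots> \<ge> 0" by simp
  finally show ?thesis .
qed

lemma prob_space_sample_space: "prob_space (sample_space D n)"
  unfolding sample_space_def by (intro prob_space_PiM prob_space_axioms)

lemma measurable_sample_cov:
  assumes "a < p" "b < p"
  shows "(\<lambda>X. sample_cov n X a b) \<in> borel_measurable (sample_space D n)"
proof -
  have "(\<lambda>X. X k c) \<in> borel_measurable (sample_space D n)" if "k < n" "c < p" for k c
    unfolding sample_space_def using that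
    by (intro measurable_compose[where f="\<lambda>X. X k" and g="\<lambda>x. x c" and N=D]
        measurable_coordinate measurable_component_singleton) auto
  then show ?thesis unfolding sample_cov_def using assms by simp
qed

lemma AE_abs_sample_cov_le_1:
  "AE X in sample_space D n. \<forall>a<p. \<forall>b<p. \<bar>sample_cov n X a b\<bar> \<le> 1"
proof -
  have "AE X in sample_space D n. \<forall>k\<in>{..<n}. (\<Sum>i<p. (X k i)\<^sup>2) \<le> 1"
    unfolding sample_space_def
    by (intro AE_finite_allI AE_PiM_component[where M="\<lambda>_. D"]) (auto intro: prob_space_axioms norm_le_1)
  then show ?thesis
  proof (eventually_elim, intro allI impI)
    fix X :: "nat \<Rightarrow> nat \<Rightarrow> real" and a b assume X: "\<forall>k\<in>{..<n}. (\<Sum>i<p. (X k i)\<^sup>2) \<le> 1" and ab: "a < p" "b < p"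
    have "\<bar>\<Sum>k<n. X k a * X k b\<bar> \<le> (\<Sum>k<n. \<bar>X k a * X k b\<bar>)" by (rule sum_abs)
    also have "\<dots> \<le> (\<Sum>k<n. 1)"
      using X ab by (intro sum_mono abs_mult_le_1_of_norm_le_1) auto
    finally show "\<bar>sample_cov n X a b\<bar> \<le> 1"
      \<comment> \<open>For \<open>n = 0\<close> the sample covariance is 0, by the convention for
        division by zero.\<close>
      by (cases "n = 0") (simp_all add: sample_cov_def field_simps)
  qed
qed

end

section \<open>Expected error\<close>

text \<open>\<open>ln y \<le> y - 1\<close> at \<open>y = \<delta> / 1.25\<close>. The lower bound
  away from 0 lets the logarithm in \<open>\<delta>\<close> be inserted into error terms that lack
  it.\<close>

lemma ln_ratio_ge:
  assumes "0 < (\<delta>::real)" "\<delta> \<le> 1" shows "1 / 5 \<le> ln (1.25 / \<delta>)"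
proof -
  have "1 / 5 \<le> 1 - 1 / (1.25 / \<delta>)" using assms by (simp add: field_simps)
  also have "\<dots> \<le> ln (1.25 / \<delta>)"
    using ln_le_minus_one[of "1 / (1.25 / \<delta>)"] ln_inverse[of "1.25 / \<delta>"] assms
    by (simp add: inverse_eq_divide)
  finally show ?thesis .
qed

text \<open>The second summand is \<open>4 * sqrt (ln p)\<close> standard deviations of the noise,
  the form to which the Gaussian tail bound applies.\<close>

lemma dp_tau_eq:
  "dp_tau \<gamma> n p \<epsilon> \<delta> = \<gamma> * sqrt (ln (real p) / real n) + 4 * dp_sigma1 n \<epsilon> \<delta> * sqrt (ln (real p))"
  by (simp add: dp_tau_def dp_sigma1_def)

text \<open>The three summands are the error on the good event, the constant part of the bad event,
  and the fourth moments of the noise. Each is compared with the rate \<open>T\<close>; the factors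
  are \<open>16 * (10 * \<gamma>^2 + 64)\<close>, \<open>84 * C1 + 168\<close> and
  \<open>12\<close>, and \<open>1024 + 168 + 12 = 1204\<close>.\<close>

lemma dp_error_bound_arith:
  fixes \<epsilon> \<delta> \<gamma> C1 :: real and n p s :: nat
  assumes n: "1 \<le> n" and p: "2 \<le> p" and np: "n \<le> p" and s: "1 \<le> s" and eps: "0 < \<epsilon>" "\<epsilon> \<le> 1"
    and del: "0 < \<delta>" "\<delta> \<le> 1" and C1: "C1 > 0"
  defines "\<sigma> \<equiv> dp_sigma1 n \<epsilon> \<delta>"
  shows "16 * (real s)\<^sup>2 * (dp_tau \<gamma> n p \<epsilon> \<delta>)\<^sup>2
      + (real p)\<^sup>2 * (8 + \<sigma>\<^sup>2 * (real p)\<^sup>2) * ((real p)\<^sup>2 * (C1 * real p powr (-8) + 2 * real p powr (-6)))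
      + (real p)\<^sup>2 * (3 * \<sigma> ^ 4 / (\<sigma>\<^sup>2 * (real p)\<^sup>2))
    \<le> (160 * \<gamma>\<^sup>2 + 84 * C1 + 1204) * real s ^ 2 * ln (real p) * ln (1.25 / \<delta>) / (real n * \<epsilon>\<^sup>2)"
proof -
  define L where "L = ln (1.25 / \<delta>)"
  define l where "l = ln (real p)"
  define T where "T = l * L / (real n * \<epsilon>\<^sup>2)"
  have L: "1 / 5 \<le> L" unfolding L_def using del by (rule ln_ratio_ge)
  have "1 / 2 \<le> ln (2::real)" using ln2_ge_two_thirds by linarith
  also have "\<dots> \<le> l" unfolding l_def using p by simp
  finally have l: "1 / 2 \<le> l" .
  have s1: "1 \<le> (real s)\<^sup>2" using s by simp
  have e2: "0 < \<epsilon>\<^sup>2" "\<epsilon>\<^sup>2 \<le> 1" using eps by (auto simp: power_le_one)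
  have T0: "0 \<le> T" unfolding T_def using L l by simp
  have lT: "l / real n \<le> 5 * T"
  proof -
    have "l * 1 \<le> l * (5 * L / \<epsilon>\<^sup>2)"
      using L l e2 by (intro mult_left_mono) (auto simp: field_simps)
    then have "l / real n \<le> l * (5 * L / \<epsilon>\<^sup>2) / real n"
      by (intro divide_right_mono) auto
    also have "\<dots> = 5 * T" by (simp add: T_def field_simps)
    finally show ?thesis .
  qed
  have nT: "1 / real n \<le> 10 * T"
  proof -
    have "1 / real n \<le> 2 * (l / real n)" using l n by (simp add: field_simps)
    with lT show ?thesis by linarith
  qed
  have sig2: "\<sigma>\<^sup>2 = 2 * L / ((real n)\<^sup>2 * \<epsilon>\<^sup>2)"
    unfolding \<sigma>_def dp_sigma1_def using L by (simp add: L_def power_divide power_mult_distrib)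
  have sigl: "\<sigma>\<^sup>2 * l \<le> 2 * T"
  proof -
    have "2 * L * l / ((real n)\<^sup>2 * \<epsilon>\<^sup>2) \<le> 2 * L * l / (real n * \<epsilon>\<^sup>2)"
      using L l n e2 by (intro divide_left_mono mult_right_mono) (auto simp: power2_eq_square)
    then show ?thesis by (simp add: sig2 T_def mult_ac)
  qed
  have sigT: "\<sigma>\<^sup>2 \<le> 4 * T"
  proof -
    have "\<sigma>\<^sup>2 * 1 \<le> \<sigma>\<^sup>2 * (2 * l)" using l by (intro mult_left_mono) auto
    with sigl show ?thesis by linarith
  qed
  have sig0: "0 < \<sigma>\<^sup>2" using L n e2 by (simp add: sig2)
  have p0: "0 < real p" "1 \<le> real p" using p by auto
  have tau: "(dp_tau \<gamma> n p \<epsilon> \<delta>)\<^sup>2 \<le> (10 * \<gamma>\<^sup>2 + 64) * T"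
  proof -
    let ?x = "\<gamma> * sqrt (l / real n)" and ?y = "4 * \<sigma> * sqrt l"
    have "(dp_tau \<gamma> n p \<epsilon> \<delta>)\<^sup>2 = (?x + ?y)\<^sup>2" by (simp add: dp_tau_eq l_def \<sigma>_def)
    also have "\<dots> \<le> 2 * ?x\<^sup>2 + 2 * ?y\<^sup>2"
      using sum_squares_bound[of ?x ?y] by (simp add: power2_sum)
    also have "?x\<^sup>2 = \<gamma>\<^sup>2 * (l / real n)"
      using l by (simp add: power_mult_distrib)
    also have "?y\<^sup>2 = 16 * (\<sigma>\<^sup>2 * l)"
      using l by (simp add: power_mult_distrib)
    also have "2 * (\<gamma>\<^sup>2 * (l / real n)) + 2 * (16 * (\<sigma>\<^sup>2 * l)) \<le> 2 * (\<gamma>\<^sup>2 * (5 * T)) + 2 * (16 * (2 * T))"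
      using lT sigl by (intro add_mono mult_left_mono) auto
    finally show ?thesis by (simp add: algebra_simps)
  qed
  have "(real p)\<^sup>2 * (C1 * real p powr (-8) + 2 * real p powr (-6)) \<le> (C1 + 2) / real p ^ 4"
  proof -
    \<comment> \<open>The weaker power serves for both failure probabilities; the union over
      \<open>p^2\<close> entries leaves order \<open>p^(-4)\<close>, which cancels the
      \<open>p^4\<close> in front of the noise variance.\<close>
    have "real p powr (-8) \<le> real p powr (-6)" using p0 by (intro powr_mono) auto
    then have "(real p)\<^sup>2 * (C1 * real p powr (-8) + 2 * real p powr (-6))
        \<le> (real p)\<^sup>2 * (C1 * real p powr (-6) + 2 * real p powr (-6))"
      using C1 by (intro mult_left_mono add_mono) auto
    also have "\<dots> = (C1 + 2) / real p ^ 4"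
    proof -
      have "real p powr (-6) = 1 / real p ^ 6"
        using p0 powr_minus_divide[of "real p" 6] by simp
      then show ?thesis using p0 by (simp add: field_simps eval_nat_numeral)
    qed
    finally show ?thesis .
  qed
  then have "(real p)\<^sup>2 * (8 + \<sigma>\<^sup>2 * (real p)\<^sup>2)
        * ((real p)\<^sup>2 * (C1 * real p powr (-8) + 2 * real p powr (-6)))
      \<le> (real p)\<^sup>2 * (8 + \<sigma>\<^sup>2 * (real p)\<^sup>2) * ((C1 + 2) / real p ^ 4)"
    by (intro mult_left_mono) auto
  also have "\<dots> = (C1 + 2) * (8 * (1 / (real p)\<^sup>2) + \<sigma>\<^sup>2)"
    using p0 by (simp add: field_simps eval_nat_numeral)
  also have "\<dots> \<le> (C1 + 2) * (8 * (10 * T) + 4 * T)"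
  proof -
    \<comment> \<open>Here \<open>n \<le> p\<close> enters: it makes \<open>1 / p^2\<close> at most
      \<open>1 / n\<close>, which is within the rate.\<close>
    have "real n \<le> (real p)\<^sup>2"
      using np p0 self_le_power[of "real p" 2] by linarith
    then have "1 / (real p)\<^sup>2 \<le> 1 / real n" using n p0 by (intro divide_left_mono) auto
    with nT have "1 / (real p)\<^sup>2 \<le> 10 * T" by linarith
    with sigT C1 show ?thesis by (intro mult_left_mono add_mono) auto
  qed
  finally have mid: "(real p)\<^sup>2 * (8 + \<sigma>\<^sup>2 * (real p)\<^sup>2)
        * ((real p)\<^sup>2 * (C1 * real p powr (-8) + 2 * real p powr (-6))) \<le> (84 * C1 + 168) * T"
    by (simp add: algebra_simps)
  have "(real p)\<^sup>2 * (3 * \<sigma> ^ 4 / (\<sigma>\<^sup>2 * (real p)\<^sup>2)) = 3 * \<sigma>\<^sup>2"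
    using p0 sig0 by (simp add: field_simps eval_nat_numeral)
  with sigT have last: "(real p)\<^sup>2 * (3 * \<sigma> ^ 4 / (\<sigma>\<^sup>2 * (real p)\<^sup>2)) \<le> 12 * T" by simp
  have "16 * (real s)\<^sup>2 * (dp_tau \<gamma> n p \<epsilon> \<delta>)\<^sup>2 \<le> 16 * (real s)\<^sup>2 * ((10 * \<gamma>\<^sup>2 + 64) * T)"
    using tau by (intro mult_left_mono) auto
  moreover have "(84 * C1 + 168) * T + 12 * T \<le> (real s)\<^sup>2 * ((84 * C1 + 168) * T + 12 * T)"
    using s1 T0 C1 mult_right_mono[of 1 "(real s)\<^sup>2" "(84 * C1 + 168) * T + 12 * T"] by simp
  ultimately have "16 * (real s)\<^sup>2 * (dp_tau \<gamma> n p \<epsilon> \<delta>)\<^sup>2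
      + (real p)\<^sup>2 * (8 + \<sigma>\<^sup>2 * (real p)\<^sup>2) * ((real p)\<^sup>2 * (C1 * real p powr (-8) + 2 * real p powr (-6)))
      + (real p)\<^sup>2 * (3 * \<sigma> ^ 4 / (\<sigma>\<^sup>2 * (real p)\<^sup>2))
    \<le> 16 * (real s)\<^sup>2 * ((10 * \<gamma>\<^sup>2 + 64) * T) + (real s)\<^sup>2 * ((84 * C1 + 168) * T + 12 * T)"
    using mid last by linarith
  also have "\<dots> = (160 * \<gamma>\<^sup>2 + 84 * C1 + 1204) * (real s)\<^sup>2 * T"
    by (simp add: algebra_simps)
  finally show ?thesis by (simp add: T_def l_def L_def mult_ac)
qed

section \<open>From a pointwise error bound to the expectation\<close>

lemma dp_sigma1_pos:
  assumes "1 \<le> n" "0 < \<epsilon>" "0 < \<delta>" "\<delta> \<le> 1"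
  shows "0 < dp_sigma1 n \<epsilon> \<delta>"
  using assms ln_ratio_ge[of \<delta>] by (simp add: dp_sigma1_def)

lemma dp_hat_commute: "dp_hat \<gamma> n p \<epsilon> \<delta> X z a b = dp_hat \<gamma> n p \<epsilon> \<delta> X z b a"
  by (simp add: dp_hat_def threshold_def dp_tilde_def sample_cov_commute[of n X a] sym_noise_commute[of z a])

text \<open>\<open>u\<close> is any nonnegative number that reaches 1 as soon as one deviation is
  too large. If \<open>1 \<le> u\<close> the crude bound applies; otherwise no deviation is too
  large and the thresholding bound applies. One inequality thus covers both events and can be
  integrated term by term.\<close>

lemma spec_norm_dp_hat_bound:
  fixes u :: real
  assumes "2 \<le> p" "1 \<le> s" "1 \<le> n" "0 < \<epsilon>" "0 < \<delta>" "\<delta> \<le> 1" "0 < \<gamma>" "0 < l" "0 \<le> u"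
    and G0: "in_G0 p s (cov_mat D)"
    and cov: "\<And>a b. a < p \<Longrightarrow> b < p \<Longrightarrow> \<bar>cov_mat D a b\<bar> \<le> 1"
    and scov: "\<And>a b. a < p \<Longrightarrow> b < p \<Longrightarrow> \<bar>sample_cov n X a b\<bar> \<le> 1"
    and u: "\<And>a b. a < p \<Longrightarrow> b < p \<Longrightarrow>
        \<bar>sample_cov n X a b - cov_mat D a b\<bar> > \<gamma> * sqrt (ln (real p) / real n) \<or>
        \<bar>sym_noise z a b\<bar> > 4 * dp_sigma1 n \<epsilon> \<delta> * sqrt (ln (real p)) \<Longrightarrow> 1 \<le> u"
  shows "(spec_norm p (\<lambda>a b. dp_hat \<gamma> n p \<epsilon> \<delta> X z a b - cov_mat D a b))\<^sup>2
    \<le> 16 * (real s)\<^sup>2 * (dp_tau \<gamma> n p \<epsilon> \<delta>)\<^sup>2 + (real p)\<^sup>2 * (8 + l) * u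
       + (\<Sum>a<p. \<Sum>b<p. sym_noise z a b ^ 4 / l)"
proof -
  let ?\<tau> = "dp_tau \<gamma> n p \<epsilon> \<delta>"
  have p: "0 < p" using assms by simp
  have \<tau>: "0 \<le> ?\<tau>"
    unfolding dp_tau_eq using assms dp_sigma1_pos[of n \<epsilon> \<delta>] by simp
  have Z: "0 \<le> (\<Sum>a<p. \<Sum>b<p. sym_noise z a b ^ 4 / l)"
    using \<open>0 < l\<close> by (intro sum_nonneg divide_nonneg_pos) auto
  show ?thesis
  proof (cases "1 \<le> u")
    case True
    have "(spec_norm p (\<lambda>a b. dp_hat \<gamma> n p \<epsilon> \<delta> X z a b - cov_mat D a b))\<^sup>2
      \<le> (real p)\<^sup>2 * (8 + l) + (\<Sum>a<p. \<Sum>b<p. sym_noise z a b ^ 4 / l)"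
      using spec_norm_threshold_crude[OF p \<open>0 < l\<close> cov scov, where Z="sym_noise z"]
      by (simp add: dp_hat_def dp_tilde_def[abs_def])
    moreover have "(real p)\<^sup>2 * (8 + l) * 1 \<le> (real p)\<^sup>2 * (8 + l) * u"
      using True \<open>0 < l\<close> by (intro mult_left_mono) auto
    moreover have "0 \<le> 16 * (real s)\<^sup>2 * ?\<tau>\<^sup>2" by simp
    ultimately show ?thesis by linarith
  next
    case False
    have "spec_norm p (\<lambda>a b. dp_hat \<gamma> n p \<epsilon> \<delta> X z a b - cov_mat D a b) \<le> 4 * real s * ?\<tau>"
      unfolding dp_hat_def
    proof (rule spec_norm_threshold_le[OF p \<open>1 \<le> s\<close> \<tau> G0])
      fix a b assume ab: "a < p" "b < p"
      show "\<bar>dp_tilde n X z a b - cov_mat D a b\<bar> \<le> ?\<tau>"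
        using u[OF ab] False unfolding dp_tilde_def dp_tau_eq by linarith
      show "cov_mat D a b = cov_mat D b a" by (rule cov_mat_commute)
      show "dp_tilde n X z a b = dp_tilde n X z b a"
        by (simp add: dp_tilde_def sample_cov_commute[of n X a] sym_noise_commute[of z a])
    qed
    then have "(spec_norm p (\<lambda>a b. dp_hat \<gamma> n p \<epsilon> \<delta> X z a b - cov_mat D a b))\<^sup>2 \<le> (4 * real s * ?\<tau>)\<^sup>2"
      by (intro power_mono spec_norm_nonneg p)
    also have "\<dots> = 16 * (real s)\<^sup>2 * ?\<tau>\<^sup>2" by (simp add: power_mult_distrib)
    finally show ?thesis
      using Z \<open>0 < l\<close> \<open>0 \<le> u\<close> by (simp add: add_nonneg_nonneg add_increasing2)
  qed
qed

text \<open>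
  \<open>F\<close> and \<open>c\<close> cover both estimators at once: scaling the integral of the error of \<open>dp_hat\<close> itself
  would require its measurability.
\<close>

lemma (in bounded_vector) expected_dp_error:
  fixes \<gamma> C1 c :: real and F :: "(nat \<Rightarrow> nat \<Rightarrow> real) \<times> (nat \<times> nat \<Rightarrow> real) \<Rightarrow> real"
  assumes "0 < \<gamma>" "0 < C1" "1 \<le> n" "2 \<le> p" "n \<le> p" "1 \<le> s"
    "0 < \<epsilon>" "\<epsilon> \<le> 1" "0 < \<delta>" "\<delta> \<le> 1"
    and G0: "in_G0 p s (cov_mat D)"
    and tail: "\<And>a b. a < p \<Longrightarrow> b < p \<Longrightarrow>
      measure (sample_space D n) {X \<in> space (sample_space D n).
          \<bar>sample_cov n X a b - cov_mat D a b\<bar> > \<gamma> * sqrt (ln (real p) / real n)}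
        \<le> C1 * real p powr (-8)"
    and "0 \<le> c"
    and F: "\<And>\<omega>. F \<omega> \<le> c * (spec_norm p (\<lambda>a b. dp_hat \<gamma> n p \<epsilon> \<delta> (fst \<omega>) (snd \<omega>) a b
              - cov_mat D a b))\<^sup>2"
  shows "(\<integral>\<^sup>+ \<omega>. ennreal (F \<omega>) \<partial>(sample_space D n \<Otimes>\<^sub>M noise_space p (dp_sigma1 n \<epsilon> \<delta>)))
      \<le> ennreal (c * ((160 * \<gamma>\<^sup>2 + 84 * C1 + 1204) * real s ^ 2 * ln (real p) * ln (1.25 / \<delta>)
            / (real n * \<epsilon>\<^sup>2)))"
proof -
  define \<sigma> where "\<sigma> = dp_sigma1 n \<epsilon> \<delta>"
  define M where "M = sample_space D n"
  define N where "N = noise_space p \<sigma>"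
  \<comment> \<open>The AM-GM weight that balances \<open>l\<close> times the failure probability against the fourth moment over \<open>l\<close>.\<close>
  define l where "l = \<sigma>\<^sup>2 * (real p)\<^sup>2"
  define A where "A a b = {X \<in> space M. \<bar>sample_cov n X a b - cov_mat D a b\<bar> > \<gamma> * sqrt (ln (real p) / real n)}" for a b
  define B where "B a b = {z \<in> space N. \<bar>sym_noise z a b\<bar> > 4 * \<sigma> * sqrt (ln (real p))}" for a b
  \<comment> \<open>The number of failures, counted over all entries of both matrices. It dominates
    the indicator of the bad event, and its expectation is the union bound.\<close>
  define u where "u \<omega> = (\<Sum>a<p. \<Sum>b<p. indicator (A a b) (fst \<omega>) + indicator (B a b) (snd \<omega>) :: real)" for \<omega>
  define Q where "Q \<omega> = (\<Sum>a<p. \<Sum>b<p. sym_noise (snd \<omega>) a b ^ 4 / l)"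
    for \<omega> :: "(nat \<Rightarrow> nat \<Rightarrow> real) \<times> (nat \<times> nat \<Rightarrow> real)"
  let ?G = "16 * (real s)\<^sup>2 * (dp_tau \<gamma> n p \<epsilon> \<delta>)\<^sup>2"
  let ?g = "\<lambda>\<omega>. ?G + (real p)\<^sup>2 * (8 + l) * u \<omega> + Q \<omega>"
  have \<sigma>: "0 < \<sigma>" unfolding \<sigma>_def using assms by (intro dp_sigma1_pos)
  have l: "0 < l" using \<sigma> assms by (simp add: l_def)
  have p: "0 < p" using assms by simp
  interpret M: prob_space M unfolding M_def by (rule prob_space_sample_space)
  interpret N: prob_space N unfolding N_def using \<sigma> by (rule prob_space_noise_space)
  interpret MN: pair_prob_space M N ..
  have A: "A a b \<in> sets M" if "a < p" "b < p" for a b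
    unfolding A_def using measurable_sample_cov[OF that, of n] by (simp add: M_def)
  have B: "B a b \<in> sets N" if "a < p" "b < p" for a b
    unfolding B_def using measurable_sym_noise[OF that, of \<sigma>] by (simp add: N_def)
  have intA: "integrable (M \<Otimes>\<^sub>M N) (\<lambda>\<omega>. indicator (A a b) (fst \<omega>) :: real)"
      "(\<integral>\<omega>. indicator (A a b) (fst \<omega>) \<partial>(M \<Otimes>\<^sub>M N)) \<le> C1 * real p powr (-8)"
    if ab: "a < p" "b < p" for a b
  proof -
    have i: "integrable M (indicator (A a b) :: _ \<Rightarrow> real)"
      using A[OF ab] by (simp add: M.emeasure_eq_measure)
    show "integrable (M \<Otimes>\<^sub>M N) (\<lambda>\<omega>. indicator (A a b) (fst \<omega>) :: real)"
      by (rule integrable_pair_fst[OF M.prob_space_axioms N.prob_space_axioms i])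
    show "(\<integral>\<omega>. indicator (A a b) (fst \<omega>) \<partial>(M \<Otimes>\<^sub>M N)) \<le> C1 * real p powr (-8)"
      using integral_pair_fst[OF M.prob_space_axioms N.prob_space_axioms i] A[OF ab] tail[OF ab]
      by (simp add: A_def M_def)
  qed
  have intB: "integrable (M \<Otimes>\<^sub>M N) (\<lambda>\<omega>. indicator (B a b) (snd \<omega>) :: real)"
      "(\<integral>\<omega>. indicator (B a b) (snd \<omega>) \<partial>(M \<Otimes>\<^sub>M N)) \<le> 2 * real p powr (-6)"
    if ab: "a < p" "b < p" for a b
  proof -
    have i: "integrable N (indicator (B a b) :: _ \<Rightarrow> real)"
      using B[OF ab] by (simp add: N.emeasure_eq_measure)
    show "integrable (M \<Otimes>\<^sub>M N) (\<lambda>\<omega>. indicator (B a b) (snd \<omega>) :: real)"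
      by (rule integrable_pair_snd[OF M.prob_space_axioms N.prob_space_axioms i])
    have "measure N (B a b) \<le> 2 * exp (- 3 * (4 * \<sigma> * sqrt (ln (real p)))\<^sup>2 / (8 * \<sigma>\<^sup>2))"
      unfolding B_def N_def using \<sigma> p by (intro sym_noise_tail ab) auto
    \<comment> \<open>The noise threshold of \<open>4 * sqrt (ln p)\<close> standard deviations
      gives the exponent \<open>3 * 16 / 8 = 6\<close>.\<close>
    also have "- 3 * (4 * \<sigma> * sqrt (ln (real p)))\<^sup>2 / (8 * \<sigma>\<^sup>2) = - 6 * ln (real p)"
      using \<sigma> p by (simp add: power_mult_distrib field_simps)
    also have "exp (- 6 * ln (real p)) = real p powr (-6)"
      using p by (simp add: powr_def)
    finally show "(\<integral>\<omega>. indicator (B a b) (snd \<omega>) \<partial>(M \<Otimes>\<^sub>M N)) \<le> 2 * real p powr (-6)"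
      using integral_pair_snd[OF M.prob_space_axioms N.prob_space_axioms i] B[OF ab] by simp
  qed
  have intZ: "integrable (M \<Otimes>\<^sub>M N) (\<lambda>\<omega>. sym_noise (snd \<omega>) a b ^ 4)"
      "(\<integral>\<omega>. sym_noise (snd \<omega>) a b ^ 4 \<partial>(M \<Otimes>\<^sub>M N)) = 3 * \<sigma> ^ 4"
    if ab: "a < p" "b < p" for a b
    using integrable_pair_snd[OF M.prob_space_axioms N.prob_space_axioms, of "\<lambda>z. sym_noise z a b ^ 4"]
      integral_pair_snd[OF M.prob_space_axioms N.prob_space_axioms, of "\<lambda>z. sym_noise z a b ^ 4"]
      integrable_sym_noise_4[OF ab \<sigma>] integral_sym_noise_4[OF ab \<sigma>]
    by (simp_all add: N_def)
  have int_u: "integrable (M \<Otimes>\<^sub>M N) u"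
    unfolding u_def using intA(1) intB(1)
    by (intro Bochner_Integration.integrable_sum Bochner_Integration.integrable_add) auto
  have int_Q: "integrable (M \<Otimes>\<^sub>M N) Q"
    unfolding Q_def using intZ(1)
    by (intro Bochner_Integration.integrable_sum integrable_divide) auto
  have u_le: "(\<integral>\<omega>. u \<omega> \<partial>(M \<Otimes>\<^sub>M N)) \<le> (real p)\<^sup>2 * (C1 * real p powr (-8) + 2 * real p powr (-6))"
  proof -
    have "(\<integral>\<omega>. u \<omega> \<partial>(M \<Otimes>\<^sub>M N)) = (\<Sum>a<p. \<Sum>b<p. (\<integral>\<omega>. indicator (A a b) (fst \<omega>) \<partial>(M \<Otimes>\<^sub>M N))
        + (\<integral>\<omega>. indicator (B a b) (snd \<omega>) \<partial>(M \<Otimes>\<^sub>M N)))"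
    proof -
      have "(\<integral>\<omega>. u \<omega> \<partial>(M \<Otimes>\<^sub>M N)) = (\<Sum>a<p. \<integral>\<omega>. (\<Sum>b<p.
          indicator (A a b) (fst \<omega>) + indicator (B a b) (snd \<omega>)) \<partial>(M \<Otimes>\<^sub>M N))"
        unfolding u_def using intA(1) intB(1)
        by (intro Bochner_Integration.integral_sum Bochner_Integration.integrable_sum
            Bochner_Integration.integrable_add) auto
      also have "\<dots> = (\<Sum>a<p. \<Sum>b<p. \<integral>\<omega>. indicator (A a b) (fst \<omega>) + indicator (B a b) (snd \<omega>) \<partial>(M \<Otimes>\<^sub>M N))"
        using intA(1) intB(1)
        by (intro sum.cong refl Bochner_Integration.integral_sum Bochner_Integration.integrable_add) auto
      also have "\<dots> = (\<Sum>a<p. \<Sum>b<p. (\<integral>\<omega>. indicator (A a b) (fst \<omega>) \<partial>(M \<Otimes>\<^sub>M N))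
          + (\<integral>\<omega>. indicator (B a b) (snd \<omega>) \<partial>(M \<Otimes>\<^sub>M N)))"
        using intA(1) intB(1) by (intro sum.cong refl Bochner_Integration.integral_add) auto
      finally show ?thesis .
    qed
    also have "\<dots> \<le> (\<Sum>a<p. \<Sum>b<p. C1 * real p powr (-8) + 2 * real p powr (-6))"
      using intA(2) intB(2) by (intro sum_mono add_mono) auto
    finally show ?thesis by (simp add: power2_eq_square mult.assoc)
  qed
  have Q_eq: "(\<integral>\<omega>. Q \<omega> \<partial>(M \<Otimes>\<^sub>M N)) = (real p)\<^sup>2 * (3 * \<sigma> ^ 4 / l)"
  proof -
    have "(\<integral>\<omega>. Q \<omega> \<partial>(M \<Otimes>\<^sub>M N)) = (\<Sum>a<p. \<integral>\<omega>. (\<Sum>b<p. sym_noise (snd \<omega>) a b ^ 4 / l) \<partial>(M \<Otimes>\<^sub>M N))"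
      unfolding Q_def using intZ(1)
      by (intro Bochner_Integration.integral_sum Bochner_Integration.integrable_sum integrable_divide) auto
    also have "\<dots> = (\<Sum>a<p. \<Sum>b<p. \<integral>\<omega>. sym_noise (snd \<omega>) a b ^ 4 / l \<partial>(M \<Otimes>\<^sub>M N))"
      using intZ(1) by (intro sum.cong refl Bochner_Integration.integral_sum integrable_divide) auto
    also have "\<dots> = (\<Sum>a<p. \<Sum>b<p. 3 * \<sigma> ^ 4 / l)"
      using intZ(2) by (intro sum.cong refl) simp
    finally show ?thesis by (simp add: power2_eq_square)
  qed
  have u0: "0 \<le> u \<omega>" for \<omega>
    unfolding u_def by (intro sum_nonneg) auto
  have u1: "1 \<le> u \<omega>" if ab: "a < p" "b < p" and "fst \<omega> \<in> A a b \<or> snd \<omega> \<in> B a b" for \<omega> a b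
  proof -
    let ?f = "\<lambda>a b. indicator (A a b) (fst \<omega>) + indicator (B a b) (snd \<omega>) :: real"
    have "1 \<le> ?f a b" using that(3) by (auto simp: indicator_def)
    also have "\<dots> \<le> (\<Sum>b<p. ?f a b)" using ab by (intro member_le_sum) auto
    also have "\<dots> \<le> u \<omega>"
      unfolding u_def using ab by (intro member_le_sum[where f="\<lambda>a. \<Sum>b<p. ?f a b"] sum_nonneg) auto
    finally show ?thesis .
  qed
  have "AE \<omega> in M \<Otimes>\<^sub>M N. \<forall>a<p. \<forall>b<p. \<bar>sample_cov n (fst \<omega>) a b\<bar> \<le> 1"
  proof (rule AE_distrD[of fst _ M])
    show "AE X in distr (M \<Otimes>\<^sub>M N) M fst. \<forall>a<p. \<forall>b<p. \<bar>sample_cov n X a b\<bar> \<le> 1"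
      unfolding N.distr_pair_fst unfolding M_def by (rule AE_abs_sample_cov_le_1)
  qed simp
  \<comment> \<open>The pointwise bound holds only almost everywhere, because the sample covariance
    is bounded by 1 only almost surely.\<close>
  then have AE: "AE \<omega> in M \<Otimes>\<^sub>M N. ennreal (F \<omega>) \<le> ennreal (c * ?g \<omega>)"
    using AE_space
  proof eventually_elim
    case (elim \<omega>)
    have sp: "fst \<omega> \<in> space M" "snd \<omega> \<in> space N" using elim(2) by (auto simp: space_pair_measure)
    have "(spec_norm p (\<lambda>a b. dp_hat \<gamma> n p \<epsilon> \<delta> (fst \<omega>) (snd \<omega>) a b - cov_mat D a b))\<^sup>2 \<le> ?g \<omega>"
      unfolding Q_def
    proof (intro spec_norm_dp_hat_bound assms l u0 abs_cov_mat_le_1)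
      fix a b assume ab: "a < p" "b < p"
      show "\<bar>sample_cov n (fst \<omega>) a b\<bar> \<le> 1" using elim(1) ab by blast
      assume "\<bar>sample_cov n (fst \<omega>) a b - cov_mat D a b\<bar> > \<gamma> * sqrt (ln (real p) / real n) \<or>
        \<bar>sym_noise (snd \<omega>) a b\<bar> > 4 * dp_sigma1 n \<epsilon> \<delta> * sqrt (ln (real p))"
      then have "fst \<omega> \<in> A a b \<or> snd \<omega> \<in> B a b"
        using sp by (auto simp: A_def B_def \<sigma>_def)
      with ab show "1 \<le> u \<omega>" by (rule u1)
    qed
    then have "F \<omega> \<le> c * ?g \<omega>"
      using F[of \<omega>] \<open>0 \<le> c\<close> by (meson mult_left_mono order_trans)
    then show ?case by (rule ennreal_leI)
  qed
  have g0: "0 \<le> ?g \<omega>" for \<omega>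
    using l u0[of \<omega>] by (auto simp: Q_def intro!: add_nonneg_nonneg sum_nonneg)
  have int_g: "integrable (M \<Otimes>\<^sub>M N) ?g"
    using int_u int_Q by (intro Bochner_Integration.integrable_add integrable_mult_right) auto
  \<comment> \<open>\<open>nn_integral\<close> is monotone for arbitrary integrands, so
    \<open>F\<close> may involve the choice made in \<open>psd_part\<close>; integrability is
    established for the dominating function.\<close>
  have "(\<integral>\<^sup>+ \<omega>. ennreal (F \<omega>) \<partial>(M \<Otimes>\<^sub>M N)) \<le> (\<integral>\<^sup>+ \<omega>. ennreal (c * ?g \<omega>) \<partial>(M \<Otimes>\<^sub>M N))"
    using AE by (rule nn_integral_mono_AE)
  also have "\<dots> = ennreal (\<integral>\<omega>. c * ?g \<omega> \<partial>(M \<Otimes>\<^sub>M N))"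
    using int_g g0 \<open>0 \<le> c\<close>
    by (intro nn_integral_eq_integral integrable_mult_right AE_I2 mult_nonneg_nonneg) auto
  also have "\<dots> = ennreal (c * (\<integral>\<omega>. ?g \<omega> \<partial>(M \<Otimes>\<^sub>M N)))"
    by (simp only: integral_mult_right_zero)
  finally have le: "(\<integral>\<^sup>+ \<omega>. ennreal (F \<omega>) \<partial>(M \<Otimes>\<^sub>M N)) \<le> ennreal (c * (\<integral>\<omega>. ?g \<omega> \<partial>(M \<Otimes>\<^sub>M N)))" .
  have "(\<integral>\<omega>. ?g \<omega> \<partial>(M \<Otimes>\<^sub>M N))
      = ?G + (real p)\<^sup>2 * (8 + l) * (\<integral>\<omega>. u \<omega> \<partial>(M \<Otimes>\<^sub>M N)) + (real p)\<^sup>2 * (3 * \<sigma> ^ 4 / l)"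
    using int_u int_Q Q_eq by (simp add: MN.prob_space)
  also have "\<dots> \<le> ?G + (real p)\<^sup>2 * (8 + l) * ((real p)\<^sup>2 * (C1 * real p powr (-8) + 2 * real p powr (-6)))
      + (real p)\<^sup>2 * (3 * \<sigma> ^ 4 / l)"
    using u_le l by (intro add_mono mult_left_mono) auto
  also have "\<dots> \<le> (160 * \<gamma>\<^sup>2 + 84 * C1 + 1204) * real s ^ 2 * ln (real p) * ln (1.25 / \<delta>) / (real n * \<epsilon>\<^sup>2)"
    unfolding l_def \<sigma>_def using assms by (intro dp_error_bound_arith)
  finally have "c * (\<integral>\<omega>. ?g \<omega> \<partial>(M \<Otimes>\<^sub>M N)) \<le> c * ((160 * \<gamma>\<^sup>2 + 84 * C1 + 1204) * real s ^ 2
      * ln (real p) * ln (1.25 / \<delta>) / (real n * \<epsilon>\<^sup>2))"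
    using \<open>0 \<le> c\<close> by (rule mult_left_mono)
  with le show ?thesis
    unfolding M_def N_def \<sigma>_def by (meson ennreal_leI order_trans)
qed

theorem theorem2:
  fixes sig2 \<gamma> C1 t0 :: real
  assumes "sig2 > 0" and "\<gamma> > 0" and "C1 > 0" and "t0 > 0"
  shows "\<exists>(C::real) (K::real). \<forall>(n::nat) (p::nat) (s::nat) (\<epsilon>::real) (\<delta>::real)
      (D :: (nat \<Rightarrow> real) measure).
    ( 1 \<le> n \<and> 2 \<le> p \<and> n \<le> p \<and> ln (real p) powr K \<le> real n \<and> 1 \<le> s
    \<and> 0 < \<epsilon> \<and> \<epsilon> \<le> 1 \<and> 0 < \<delta> \<and> \<delta> \<le> 1
    \<and> prob_space D \<and> sets D = sets (PiM {..<p} (\<lambda>_. borel :: real measure))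
    \<and> (\<forall>i<p. (\<integral>x. x i \<partial>D) = 0)
    \<and> (AE x in D. (\<Sum>i<p. (x i)\<^sup>2) \<le> 1)
    \<and> (\<forall>v. (\<Sum>i<p. (v i)\<^sup>2) = 1 \<longrightarrow> (\<forall>t>0.
          measure D {x \<in> space D. \<bar>\<Sum>i<p. v i * x i\<bar> > t} \<le> exp (- t\<^sup>2 / (2 * sig2))))
    \<and> in_G0 p s (cov_mat D)
    \<and> (\<forall>a<p. \<forall>b<p. \<forall>t. 0 < t \<and> t \<le> t0 \<longrightarrow>
          measure (sample_space D n) {X \<in> space (sample_space D n).
              \<bar>sample_cov n X a b - cov_mat D a b\<bar> > t}
            \<le> C1 * exp (- 8 * real n * t\<^sup>2 / \<gamma>\<^sup>2))
    \<and> (\<forall>a<p. \<forall>b<p.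
          measure (sample_space D n) {X \<in> space (sample_space D n).
              \<bar>sample_cov n X a b - cov_mat D a b\<bar> > \<gamma> * sqrt (ln (real p) / real n)}
            \<le> C1 * real p powr (-8)) )
    \<longrightarrow>
    (\<integral>\<^sup>+ \<omega>. ennreal ((spec_norm p (\<lambda>a b. dp_hat \<gamma> n p \<epsilon> \<delta> (fst \<omega>) (snd \<omega>) a b
              - cov_mat D a b))\<^sup>2)
        \<partial>(sample_space D n \<Otimes>\<^sub>M noise_space p (dp_sigma1 n \<epsilon> \<delta>)))
      \<le> ennreal (C * real s ^ 2 * ln (real p) * ln (1.25 / \<delta>) / (real n * \<epsilon>\<^sup>2))
    \<and>
    (\<integral>\<^sup>+ \<omega>. ennreal ((spec_norm p (\<lambda>a b. dp_plus \<gamma> n p \<epsilon> \<delta> (fst \<omega>) (snd \<omega>) a b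
              - cov_mat D a b))\<^sup>2)
        \<partial>(sample_space D n \<Otimes>\<^sub>M noise_space p (dp_sigma1 n \<epsilon> \<delta>)))
      \<le> ennreal (C * real s ^ 2 * ln (real p) * ln (1.25 / \<delta>) / (real n * \<epsilon>\<^sup>2))"
proof (intro exI[of _ "4 * (160 * \<gamma>\<^sup>2 + 84 * C1 + 1204)"] exI[of _ 1] allI impI, elim conjE)
  fix n p s :: nat and \<epsilon> \<delta> :: real and D :: "(nat \<Rightarrow> real) measure"
  assume range: "1 \<le> n" "2 \<le> p" "n \<le> p" "1 \<le> s" "0 < \<epsilon>" "\<epsilon> \<le> 1" "0 < \<delta>" "\<delta> \<le> 1"
    and D: "prob_space D" "sets D = sets (PiM {..<p} (\<lambda>_. borel :: real measure))"
      "AE x in D. (\<Sum>i<p. (x i)\<^sup>2) \<le> 1"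
    and G0: "in_G0 p s (cov_mat D)"
    and tail: "\<forall>a<p. \<forall>b<p.
          measure (sample_space D n) {X \<in> space (sample_space D n).
              \<bar>sample_cov n X a b - cov_mat D a b\<bar> > \<gamma> * sqrt (ln (real p) / real n)}
            \<le> C1 * real p powr (-8)"
  interpret bounded_vector D p
    using D by (simp add: bounded_vector_def bounded_vector_axioms_def)
  let ?hat = "\<lambda>\<omega>. spec_norm p (\<lambda>a b. dp_hat \<gamma> n p \<epsilon> \<delta> (fst \<omega>) (snd \<omega>) a b - cov_mat D a b)"
  let ?plus = "\<lambda>\<omega>. spec_norm p (\<lambda>a b. dp_plus \<gamma> n p \<epsilon> \<delta> (fst \<omega>) (snd \<omega>) a b - cov_mat D a b)"
  have p: "0 < p" using range by simp
  have plus: "(?plus \<omega>)\<^sup>2 \<le> 4 * (?hat \<omega>)\<^sup>2" for \<omega>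
  proof -
    have "?plus \<omega> \<le> 2 * ?hat \<omega>"
      unfolding dp_plus_def by (intro spec_norm_psd_part_le p dp_hat_commute cov_mat_psd)
    then have "(?plus \<omega>)\<^sup>2 \<le> (2 * ?hat \<omega>)\<^sup>2"
      by (intro power_mono spec_norm_nonneg p)
    then show ?thesis by (simp add: power_mult_distrib)
  qed
  have eq: "4 * ((160 * \<gamma>\<^sup>2 + 84 * C1 + 1204) * real s ^ 2 * ln (real p) * ln (1.25 / \<delta>) / (real n * \<epsilon>\<^sup>2))
      = 4 * (160 * \<gamma>\<^sup>2 + 84 * C1 + 1204) * real s ^ 2 * ln (real p) * ln (1.25 / \<delta>) / (real n * \<epsilon>\<^sup>2)"
    by simp
  \<comment> \<open>\<open>c = 4\<close> is the square of the factor 2 lost in passing to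
    \<open>dp_plus\<close>; it also dominates the error of \<open>dp_hat\<close>, so one constant
    serves both estimators.\<close>
  note bound = expected_dp_error[OF \<open>\<gamma> > 0\<close> \<open>C1 > 0\<close> range G0 tail[rule_format], of 4, unfolded eq]
  show "(\<integral>\<^sup>+ \<omega>. ennreal ((?hat \<omega>)\<^sup>2) \<partial>(sample_space D n \<Otimes>\<^sub>M noise_space p (dp_sigma1 n \<epsilon> \<delta>)))
      \<le> ennreal (4 * (160 * \<gamma>\<^sup>2 + 84 * C1 + 1204) * real s ^ 2 * ln (real p) * ln (1.25 / \<delta>) / (real n * \<epsilon>\<^sup>2))
    \<and> (\<integral>\<^sup>+ \<omega>. ennreal ((?plus \<omega>)\<^sup>2) \<partial>(sample_space D n \<Otimes>\<^sub>M noise_space p (dp_sigma1 n \<epsilon> \<delta>)))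
      \<le> ennreal (4 * (160 * \<gamma>\<^sup>2 + 84 * C1 + 1204) * real s ^ 2 * ln (real p) * ln (1.25 / \<delta>) / (real n * \<epsilon>\<^sup>2))"
    by (intro conjI bound plus) simp_all
qed

end
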